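(* Let $S\mapsto\mathcal{F}(S)/\!\!\sim_S$ be a model functor $\mathbf{FI}\to\mathbf{PF}$. Then there exists a quasipolynomial $f$ such that the number of $\mathrm{Sym}([n])$-orbits on $\mathcal{F}([n])/\!\!\sim_{[n]}$ equals $f(n)$ for all $n\gg 0$.
   Context: $[n]=\{1,\dots,n\}$. $\mathbf{FI}$ is the category of finite sets with injections. $\mathbf{PF}$ is the category of finite sets with partially defined maps (composition is defined where it makes sense). All functors $\mathbf{FI}\to\mathbf{PF}$ considered are contravariant. Model functor. Fix a finite set $S_0$, a $k\in\mathbb{Z}_{\ge 0}$, and for each finite set $S$ a subset $\mathcal{E}(S)\subseteq[k]^S$ such that for each injection $\pi:S\to T$ and each $\alpha\in\mathcal{E}(T)$ we have $\alpha\circ\pi\in\mathcal{E}(S)$. Define a contravariant functor $\mathcal{F}:\mathbf{FI}\to\mathbf{PF}$ on objects by $$\mathcal{F}(S)=\{(\sigma,\alpha)\mid \sigma:S_0\to S\text{ injective},\ \alpha\in\mathcal{E}(S\setminus\mathrm{im}(\sigma))\}$$ and, for an injection $\pi:S\to T$ and $(\sigma,\alpha)\in\mathcal{F}(T)$, let $\mathcal{F}(\pi)((\sigma,\alpha))$ be undefined if $\mathrm{im}(\sigma)\not\subseteq\mathrm{im}(\pi)$, and otherwise let it be $(\sigma',\alpha\circ\pi|_{S\setminus\mathrm{im}(\sigma')})$ where $\sigma':=\pi^{-1}\circ\sigma$. Let $\sim_S$ be an equivalence relation on $\mathcal{F}(S)$ for each finite set $S$, such that: Axiom (1): if $(\sigma,\alpha)\sim_T(\sigma',\alpha')$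 and the injection $\pi:S\to T$ has $\mathrm{im}(\pi)\supseteq\mathrm{im}(\sigma)\cup\mathrm{im}(\sigma')$, then $\mathcal{F}(\pi)((\sigma,\alpha))\sim_S\mathcal{F}(\pi)((\sigma',\alpha'))$. Axiom (2): if $(\sigma,\alpha)\in\mathcal{F}(T)$, $(\sigma'',\alpha'')\in\mathcal{F}(S)$ and the injection $\pi:S\to T$ satisfy $\mathrm{im}(\pi)\supseteq\mathrm{im}(\sigma)$ and $\mathcal{F}(\pi)((\sigma,\alpha))\sim_S(\sigma'',\alpha'')$, then there exists $(\sigma',\alpha')\in\mathcal{F}(T)$ with $\mathrm{im}(\sigma')\subseteq\mathrm{im}(\pi)$ such that $(\sigma',\alpha')\sim_T(\sigma,\alpha)$ and $\mathcal{F}(\pi)((\sigma',\alpha'))=(\sigma'',\alpha'')$. Axiom (3): if $(\sigma,\alpha)\sim_T(\sigma',\alpha')$ and $i,j\in T\setminus(\mathrm{im}(\sigma)\cup\mathrm{im}(\sigma'))$, then $\alpha(i)=\alpha(j)\Leftrightarrow\alpha'(i)=\alpha'(j)$. The functor $S\mapsto\mathcal{F}(S)/\!\!\sim_S$ so obtained is called a model functor. By Axiom (1), the action of $\mathrm{Sym}(S)$ on $\mathcal{F}(S)$ via the bijections $\mathcal{F}(\pi)$, $\pi\in\mathrm{Sym}(S)$, descends to $\mathcal{F}(S)/\!\!\sim_S$. A quasipolynomial is a function $f:\mathbb{Z}\to\mathbb{R}$ of the form $f(n)=c_d(n)n^d+\cdots+c_0(n)$ where each $c_i:\mathbb{Z}\to\mathbb{R}$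 is periodic with integral period. *)

theory Defs
  imports Complex_Main "HOL-Algebra.Sym_Groups" "HOL-Algebra.Group_Action"
begin

text \<open>
  The finite sets \<open>S\<close>, \<open>T\<close> on which functors are evaluated are the finite sets of natural
  numbers. They form a full subcategory of \<open>FI\<close> that is equivalent to \<open>FI\<close> and contains all
  the sets \<open>[n] = {1..n}\<close>. The fixed finite set \<open>S0\<close> may live in any type.

  An element of \<open>[k]\<^sup>S\<close> is an extensional function in \<open>S \<rightarrow>\<^sub>E {1..k}\<close>, so that equality in
  HOL is equality of maps on \<open>S\<close>; likewise for the injections \<open>\<sigma>\<close>. A morphism \<open>\<pi>\<close> is not
  required to be extensional (so that permutations in the sense of \<^const>\<open>permutes\<close> are
  covered); everything below depends only on its values on \<open>S\<close>.
\<close>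

definition injections :: "'a set \<Rightarrow> 'b set \<Rightarrow> ('a \<Rightarrow> 'b) set" where
  "injections S T = {\<pi> \<in> S \<rightarrow> T. inj_on \<pi> S}"

type_synonym 's elt = "('s \<Rightarrow> nat) \<times> (nat \<Rightarrow> nat)"

definition F_obj :: "'s set \<Rightarrow> (nat set \<Rightarrow> (nat \<Rightarrow> nat) set) \<Rightarrow> nat set \<Rightarrow> 's elt set" where
  "F_obj S0 E S = {(\<sigma>, \<alpha>). \<sigma> \<in> S0 \<rightarrow>\<^sub>E S \<and> inj_on \<sigma> S0 \<and> \<alpha> \<in> E (S - \<sigma> ` S0)}"

text \<open>
  The partially defined map \<open>\<F>(\<pi>) : \<F>(T) \<rightarrow> \<F>(S)\<close> of an injection \<open>\<pi> : S \<rightarrow> T\<close>, with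
  \<^const>\<open>None\<close> for ``undefined''. It does not depend on \<open>T\<close>.
\<close>

definition F_map :: "'s set \<Rightarrow> nat set \<Rightarrow> (nat \<Rightarrow> nat) \<Rightarrow> 's elt \<Rightarrow> 's elt option" where
  "F_map S0 S \<pi> = (\<lambda>(\<sigma>, \<alpha>).
     if \<sigma> ` S0 \<subseteq> \<pi> ` S then
       (let \<sigma>' = compose S0 (inv_into S \<pi>) \<sigma>
        in Some (\<sigma>', compose (S - \<sigma>' ` S0) \<alpha> \<pi>))
     else None)"

locale model_functor =
  fixes S0 :: "'s set"
    and k :: nat
    and E :: "nat set \<Rightarrow> (nat \<Rightarrow> nat) set"
    and R :: "nat set \<Rightarrow> ('s elt \<times> 's elt) set"
  assumes finite_S0: "finite S0"
    and E_subset: "\<And>S. finite S \<Longrightarrow> E S \<subseteq> S \<rightarrow>\<^sub>E {1..k}"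
    and E_closed: "\<And>S T \<pi> \<alpha>. \<lbrakk>finite S; finite T; \<pi> \<in> injections S T; \<alpha> \<in> E T\<rbrakk>
        \<Longrightarrow> compose S \<alpha> \<pi> \<in> E S"
    and equiv_R: "\<And>S. finite S \<Longrightarrow> equiv (F_obj S0 E S) (R S)"
    and axiom1: "\<And>S T \<pi> \<sigma> \<alpha> \<sigma>' \<alpha>'.
        \<lbrakk>finite S; finite T; \<pi> \<in> injections S T; ((\<sigma>, \<alpha>), (\<sigma>', \<alpha>')) \<in> R T;
         \<sigma> ` S0 \<union> \<sigma>' ` S0 \<subseteq> \<pi> ` S\<rbrakk>
        \<Longrightarrow> (the (F_map S0 S \<pi> (\<sigma>, \<alpha>)), the (F_map S0 S \<pi> (\<sigma>', \<alpha>'))) \<in> R S"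
    and axiom2: "\<And>S T \<pi> \<sigma> \<alpha> \<sigma>'' \<alpha>''.
        \<lbrakk>finite S; finite T; \<pi> \<in> injections S T;
         (\<sigma>, \<alpha>) \<in> F_obj S0 E T; (\<sigma>'', \<alpha>'') \<in> F_obj S0 E S; \<sigma> ` S0 \<subseteq> \<pi> ` S;
         (the (F_map S0 S \<pi> (\<sigma>, \<alpha>)), (\<sigma>'', \<alpha>'')) \<in> R S\<rbrakk>
        \<Longrightarrow> \<exists>\<sigma>' \<alpha>'. (\<sigma>', \<alpha>') \<in> F_obj S0 E T \<and> \<sigma>' ` S0 \<subseteq> \<pi> ` S \<and>
              ((\<sigma>', \<alpha>'), (\<sigma>, \<alpha>)) \<in> R T \<and> F_map S0 S \<pi> (\<sigma>', \<alpha>') = Some (\<sigma>'', \<alpha>'')"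
    and axiom3: "\<And>T \<sigma> \<alpha> \<sigma>' \<alpha>' i j.
        \<lbrakk>finite T; ((\<sigma>, \<alpha>), (\<sigma>', \<alpha>')) \<in> R T;
         i \<in> T - (\<sigma> ` S0 \<union> \<sigma>' ` S0); j \<in> T - (\<sigma> ` S0 \<union> \<sigma>' ` S0)\<rbrakk>
        \<Longrightarrow> \<alpha> i = \<alpha> j \<longleftrightarrow> \<alpha>' i = \<alpha>' j"

definition model_obj ::
    "'s set \<Rightarrow> (nat set \<Rightarrow> (nat \<Rightarrow> nat) set) \<Rightarrow> (nat set \<Rightarrow> ('s elt \<times> 's elt) set)
      \<Rightarrow> nat set \<Rightarrow> 's elt set set" where
  "model_obj S0 E R S = F_obj S0 E S // R S"

text \<open>
  The partial map induced on classes: it is defined on a class \<open>C\<close> iff \<open>\<F>(\<pi>)\<close> is defined on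
  some representative, and the result is the class of the images of those representatives
  (a single class, by \<open>axiom1\<close> of \<open>model_functor\<close>).
\<close>

definition model_map ::
    "'s set \<Rightarrow> (nat set \<Rightarrow> ('s elt \<times> 's elt) set) \<Rightarrow> nat set \<Rightarrow> (nat \<Rightarrow> nat)
      \<Rightarrow> 's elt set \<Rightarrow> 's elt set option" where
  "model_map S0 R S \<pi> C =
     (let D = {y. \<exists>x\<in>C. F_map S0 S \<pi> x = Some y}
      in if D = {} then None else Some (R S `` D))"

text \<open>
  The functor is contravariant, hence the inverse makes the action of \<open>Sym([n])\<close> a left action;
  this does not affect the orbits.
\<close>

definition sym_action ::
    "'s set \<Rightarrow> (nat set \<Rightarrow> (nat \<Rightarrow> nat) set) \<Rightarrow> (nat set \<Rightarrow> ('s elt \<times> 's elt) set)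
      \<Rightarrow> nat \<Rightarrow> (nat \<Rightarrow> nat) \<Rightarrow> 's elt set \<Rightarrow> 's elt set" where
  "sym_action S0 E R n p =
     (\<lambda>C\<in>model_obj S0 E R {1..n}. the (model_map S0 R {1..n} (inv' p) C))"

definition quasipolynomial :: "(int \<Rightarrow> real) \<Rightarrow> bool" where
  "quasipolynomial f \<longleftrightarrow>
     (\<exists>(d::nat) (c :: nat \<Rightarrow> int \<Rightarrow> real).
        (\<forall>i\<le>d. \<exists>p::int. p > 0 \<and> (\<forall>n. c i (n + p) = c i n)) \<and>
        (\<forall>n. f n = (\<Sum>i\<le>d. c i n * of_int n ^ i)))"

end

theory Submission
  imports Defs "HOL-Computational_Algebra.Polynomial" "HOL-Library.Fun_Lexorder"
begin

text \<open>
  Up to \<open>Sym([n])\<close>, an element \<open>(\<sigma>, \<alpha>)\<close> is determined by the vector counting how often \<open>\<alpha>\<close> takes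
  each colour, so the orbits correspond to classes of such vectors, and they are counted by their
  lexicographically least members. Equivalent elements have, up to a permutation \<open>\<rho>\<close> of the
  colours, counts that differ by a bounded vector \<open>\<delta>\<close>; there are finitely many pairs \<open>(\<rho>, \<delta>)\<close>.
  The vectors for which a given \<open>(\<rho>, \<delta>)\<close> occurs are closed under decreasing large coordinates
  (delete a point outside both images), so that membership depends only on truncated coordinates.
  Hence being least depends only on truncated coordinates and truncated differences of coordinates,
  and the vectors of coordinate sum \<open>n\<close> with such a property are counted by a quasipolynomial.
\<close>

section \<open>Sequences that are eventually quasipolynomial\<close>

text \<open>One pair (\<open>\<rho>\<close>, \<open>\<delta>\<close>) acts on count vectors only as
  a partial map, and the axioms do not describe its domain. What they give is deletion of points, by
  \<open>axiom1\<close> for the inclusion of a smaller set. A colour used at most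
  \<open>card S0\<close> times may sit entirely inside the image of the other injection, so deletion
  is guaranteed only above \<open>card S0\<close> and the domain need not be downward closed. This
  weak closure still leaves only finitely much information, although the truncation bound comes from
  a stabilising chain and is not explicit. The partial maps need not form a group, so
  representatives are counted instead of averaging fixed points. The lexicographic order suits this:
  comparing \<open>a\<close> with its partner only asks for the signs of
  \<open>a (\<rho> i) + \<delta> i - a i\<close>, and as \<open>\<delta> i\<close> is at most
  \<open>card S0\<close> in absolute value, larger differences of coordinates need not be known
  exactly.\<close>

definition quasipoly_at_top :: "nat \<Rightarrow> (nat \<Rightarrow> real) \<Rightarrow> bool" where
  "quasipoly_at_top W f \<longleftrightarrow> W > 0 \<and> (\<exists>Q N. \<forall>n\<ge>N. f n = poly (Q (n mod W)) (real n))"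

lemma quasipoly_at_topI:
  assumes "W > 0" "\<And>n. n \<ge> N \<Longrightarrow> f n = poly (Q (n mod W)) (real n)"
  shows "quasipoly_at_top W f"
  using assms unfolding quasipoly_at_top_def by blast

lemma quasipoly_at_topE:
  assumes "quasipoly_at_top W f"
  obtains Q N where "W > 0" "\<And>n. n \<ge> N \<Longrightarrow> f n = poly (Q (n mod W)) (real n)"
  using assms unfolding quasipoly_at_top_def by blast

lemma quasipoly_at_top_cong:
  assumes "quasipoly_at_top W f" "\<And>n. n \<ge> M \<Longrightarrow> f n = g n"
  shows "quasipoly_at_top W g"
proof -
  obtain Q N where "W > 0" and Q: "\<And>n. n \<ge> N \<Longrightarrow> f n = poly (Q (n mod W)) (real n)"
    using assms(1) by (rule quasipoly_at_topE) blast
  show ?thesis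
    by (rule quasipoly_at_topI[where N = "max M N" and Q = Q])
       (use \<open>W > 0\<close> Q assms(2) in \<open>auto simp flip: assms(2)\<close>)
qed

lemma quasipoly_at_top_dvd:
  assumes "quasipoly_at_top W f" "W dvd V" "V > 0"
  shows "quasipoly_at_top V f"
proof -
  obtain Q N where "W > 0" and Q: "\<And>n. n \<ge> N \<Longrightarrow> f n = poly (Q (n mod W)) (real n)"
    using assms(1) by (rule quasipoly_at_topE) blast
  show ?thesis
    by (rule quasipoly_at_topI[where N = N and Q = "\<lambda>r. Q (r mod W)"])
       (use assms Q in \<open>auto simp: mod_mod_cancel\<close>)
qed

lemma quasipoly_at_top_add_same:
  assumes "quasipoly_at_top W f" "quasipoly_at_top W g"
  shows "quasipoly_at_top W (\<lambda>n. f n + g n)"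
proof -
  obtain Q N where "W > 0" and Q: "\<And>n. n \<ge> N \<Longrightarrow> f n = poly (Q (n mod W)) (real n)"
    using assms(1) by (rule quasipoly_at_topE) blast
  obtain Q' N' where Q': "\<And>n. n \<ge> N' \<Longrightarrow> g n = poly (Q' (n mod W)) (real n)"
    using assms(2) by (rule quasipoly_at_topE) blast
  show ?thesis
    by (rule quasipoly_at_topI[where N = "max N N'" and Q = "\<lambda>r. Q r + Q' r"])
       (use \<open>W > 0\<close> Q Q' in auto)
qed

lemma quasipoly_at_top_0: "W > 0 \<Longrightarrow> quasipoly_at_top W (\<lambda>_. 0)"
  by (rule quasipoly_at_topI[where Q = "\<lambda>_. 0"]) auto

lemma quasipoly_at_top_sum_same:
  assumes "finite A" "W > 0" "\<And>x. x \<in> A \<Longrightarrow> quasipoly_at_top W (f x)"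
  shows "quasipoly_at_top W (\<lambda>n. \<Sum>x\<in>A. f x n)"
  using assms
  by (induction A rule: finite_induct)
     (auto intro: quasipoly_at_top_0 quasipoly_at_top_add_same)

lemma quasipoly_at_top_shift_up:
  assumes "quasipoly_at_top W f"
  shows "quasipoly_at_top W (\<lambda>n. f (n + s))"
proof -
  obtain Q N where "W > 0" and Q: "\<And>n. n \<ge> N \<Longrightarrow> f n = poly (Q (n mod W)) (real n)"
    using assms by (rule quasipoly_at_topE) blast
  show ?thesis
    by (rule quasipoly_at_topI[where N = N and Q = "\<lambda>r. pcompose (Q ((r + s) mod W)) [:real s, 1:]"])
       (use \<open>W > 0\<close> Q in \<open>auto simp: poly_pcompose mod_simps ac_simps\<close>)
qed

lemma quasipoly_at_top_shift_down:
  assumes "quasipoly_at_top W f"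
  shows "quasipoly_at_top W (\<lambda>n. f (n - s))"
proof -
  obtain Q N where W: "W > 0" and Q: "\<And>n. n \<ge> N \<Longrightarrow> f n = poly (Q (n mod W)) (real n)"
    using assms by (rule quasipoly_at_topE) blast
  \<comment> \<open>Modulo \<open>W\<close>, adding \<open>(W - 1) * s\<close> amounts to
    subtracting \<open>s\<close>, without truncated subtraction.\<close>
  let ?Q = "\<lambda>r. pcompose (Q ((r + (W - 1) * s) mod W)) [:- real s, 1:]"
  show ?thesis
  proof (rule quasipoly_at_topI[where N = "N + s" and Q = ?Q])
    fix n assume n: "n \<ge> N + s"
    then obtain j where j: "n = j + s" by (metis add_leD2 le_Suc_ex add.commute)
    have "(n mod W + (W - 1) * s) mod W = (j + s + (W - 1) * s) mod W"
      by (simp add: j mod_add_left_eq)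
    also have "j + s + (W - 1) * s = j + W * s"
      using W by (cases W) auto
    finally have "(n mod W + (W - 1) * s) mod W = j mod W" by simp
    then show "f (n - s) = poly (?Q (n mod W)) (real n)"
      using Q[of j] n by (simp add: poly_pcompose j)
  qed (use W in simp)
qed

section \<open>Antidifferences of polynomials and of quasipolynomials\<close>

text \<open>By the binomial theorem, the difference of \<open>x ^ Suc d\<close> with step
  \<open>h\<close> is \<open>c d * x ^ d\<close> plus lower powers of \<open>x\<close>. The
  antidifferences of these lower powers, known by induction, cancel them, and
  \<open>c d = (d + 1) * h\<close> is nonzero.\<close>

lemma monom_antidifference:
  fixes h :: real
  assumes "h \<noteq> 0"
  shows "\<exists>q. \<forall>x. poly q (x + h) - poly q x = x ^ d"
proof (induction d rule: less_induct)
  case (less d)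
  then obtain q where q: "\<And>j x. j < d \<Longrightarrow> poly (q j) (x + h) - poly (q j) x = x ^ j"
    by metis
  define c where "c j = real (Suc d choose j) * h ^ (Suc d - j)" for j
  define p where "p = smult (inverse (c d)) (monom 1 (Suc d) - (\<Sum>j<d. smult (c j) (q j)))"
  have cd: "c d \<noteq> 0" using assms by (simp add: c_def)
  have "poly p (x + h) - poly p x = x ^ d" for x
  proof -
    have "(x + h) ^ Suc d = (\<Sum>j\<le>Suc d. c j * x ^ j)"
      unfolding binomial_ring c_def by (rule sum.cong) (auto simp: mult_ac)
    also have "\<dots> = (\<Sum>j<d. c j * x ^ j) + c d * x ^ d + x ^ Suc d"
      by (simp add: c_def lessThan_Suc_atMost[symmetric])
    finally have "(x + h) ^ Suc d - x ^ Suc d - (\<Sum>j<d. c j * x ^ j) = c d * x ^ d"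
      by simp
    moreover have "(\<Sum>j<d. c j * x ^ j)
        = (\<Sum>j<d. c j * poly (q j) (x + h)) - (\<Sum>j<d. c j * poly (q j) x)"
      unfolding sum_subtractf[symmetric]
      by (rule sum.cong) (use q in \<open>auto simp flip: right_diff_distrib\<close>)
    moreover have "c d * poly p y = y ^ Suc d - (\<Sum>j<d. c j * poly (q j) y)" for y
      using cd by (simp add: p_def poly_monom poly_sum)
    ultimately have "c d * (poly p (x + h) - poly p x) = c d * x ^ d"
      by (simp only: right_diff_distrib)
    with cd show ?thesis by simp
  qed
  then show ?case by blast
qed

lemma poly_antidifference:
  fixes h :: real
  assumes "h \<noteq> 0"
  shows "\<exists>q. \<forall>x. poly q (x + h) - poly q x = poly p x"
proof -
  obtain q where q: "\<And>d x. poly (q d) (x + h) - poly (q d) x = x ^ d"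
    using monom_antidifference[OF assms] by metis
  define r where "r = (\<Sum>i\<le>degree p. smult (coeff p i) (q i))"
  have "poly r (x + h) - poly r x = poly p x" for x
  proof -
    have "poly r (x + h) - poly r x
        = (\<Sum>i\<le>degree p. coeff p i * (poly (q i) (x + h) - poly (q i) x))"
      by (simp add: r_def poly_sum right_diff_distrib sum_subtractf)
    then show ?thesis by (simp only: q poly_altdef[of p])
  qed
  then show ?thesis by blast
qed

text \<open>The step equals the period, so the recurrence stays within one residue class. There a
  polynomial antidifference \<open>H r\<close> of \<open>Q r\<close> solves it, and \<open>F\<close>
  differs from \<open>H r\<close> by a constant \<open>K r\<close>.\<close>

lemma quasipoly_at_top_antidifference_same:
  assumes f: "quasipoly_at_top V f" and F: "\<And>n. n \<ge> M \<Longrightarrow> F (n + V) = F n + f n"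
  shows "quasipoly_at_top V F"
proof -
  obtain Q N where V: "V > 0" and Q: "\<And>n. n \<ge> N \<Longrightarrow> f n = poly (Q (n mod V)) (real n)"
    using f by (rule quasipoly_at_topE) blast
  obtain H where H: "\<And>r x. poly (H r) (x + real V) - poly (H r) x = poly (Q r) x"
  proof -
    have "\<forall>r. \<exists>q. \<forall>x. poly q (x + real V) - poly q x = poly (Q r) x"
      using poly_antidifference[of "real V"] V by simp
    then show thesis using that by metis
  qed
  \<comment> \<open>A starting point beyond both thresholds that is a multiple of \<open>V\<close>,
    so that adding it keeps residues.\<close>
  define B where "B = V * (M + N)"
  have "B \<ge> M + N" using V by (cases V) (auto simp: B_def)
  then have B: "B \<ge> M" "B \<ge> N" by simp_all
  have B0: "B mod V = 0" by (simp add: B_def)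
  define K where "K r = F (r + B) - poly (H r) (real (r + B))" for r
  have *: "F (r + B + V * t) = poly (H r) (real (r + B + V * t)) + K r" if "r < V" for r t
  proof (induction t)
    case (Suc t)
    have r: "(r + B + V * t) mod V = r"
      using that B0 by (metis add_0_right mod_add_right_eq mod_less mod_mult_self2)
    have "F (r + B + V * Suc t) = F ((r + B + V * t) + V)"
      by (simp add: algebra_simps)
    also have "\<dots> = F (r + B + V * t) + poly (Q r) (real (r + B + V * t))"
      using F[of "r + B + V * t"] Q[of "r + B + V * t"] r B by simp
    also have "\<dots> = poly (H r) (real (r + B + V * t) + real V) + K r"
      unfolding Suc using H[of r "real (r + B + V * t)"] by simp
    finally show ?case by (simp add: algebra_simps)
  qed (simp add: K_def)
  show ?thesis
  proof (rule quasipoly_at_topI[where N = "V + B" and Q = "\<lambda>r. H r + [:K r:]"])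
    fix n assume n: "n \<ge> V + B"
    have "(n - B) mod V = n mod V"
      using n B0 by (metis add_0_right le_add_diff_inverse2 mod_add_right_eq add_leD2)
    then have "n = n mod V + B + V * ((n - B) div V)"
      using n mult_div_mod_eq[of V "n - B"] by linarith
    then show "F n = poly (H (n mod V) + [:K (n mod V):]) (real n)"
      using *[of "n mod V" "(n - B) div V"] V by auto
  qed (rule V)
qed

text \<open>The period stays explicit in \<open>quasipoly_at_top\<close>, because sequences must be
  brought to a common period before they can be combined.\<close>

definition eventually_quasipoly :: "(nat \<Rightarrow> real) \<Rightarrow> bool" where
  "eventually_quasipoly f \<longleftrightarrow> (\<exists>W. quasipoly_at_top W f)"

lemma quasipoly_at_top_period_pos: "quasipoly_at_top W f \<Longrightarrow> W > 0"
  by (simp add: quasipoly_at_top_def)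

lemma eventually_quasipoly_cong:
  "eventually_quasipoly f \<Longrightarrow> (\<And>n. n \<ge> M \<Longrightarrow> f n = g n) \<Longrightarrow> eventually_quasipoly g"
  unfolding eventually_quasipoly_def by (meson quasipoly_at_top_cong)

lemma eventually_quasipoly_0: "eventually_quasipoly (\<lambda>_. 0)"
  unfolding eventually_quasipoly_def using quasipoly_at_top_0[of 1] by auto

lemma eventually_quasipoly_add:
  assumes "eventually_quasipoly f" "eventually_quasipoly g"
  shows "eventually_quasipoly (\<lambda>n. f n + g n)"
proof -
  obtain W V where f: "quasipoly_at_top W f" and g: "quasipoly_at_top V g"
    using assms unfolding eventually_quasipoly_def by blast
  then have "W * V > 0" by (simp add: quasipoly_at_top_period_pos)
  then have "quasipoly_at_top (W * V) (\<lambda>n. f n + g n)"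
    by (intro quasipoly_at_top_add_same quasipoly_at_top_dvd[OF f] quasipoly_at_top_dvd[OF g]) auto
  then show ?thesis unfolding eventually_quasipoly_def ..
qed

lemma eventually_quasipoly_sum:
  assumes "finite A" "\<And>x. x \<in> A \<Longrightarrow> eventually_quasipoly (f x)"
  shows "eventually_quasipoly (\<lambda>n. \<Sum>x\<in>A. f x n)"
  using assms
  by (induction A rule: finite_induct) (auto intro: eventually_quasipoly_0 eventually_quasipoly_add)

lemma eventually_quasipoly_shift_up:
  "eventually_quasipoly f \<Longrightarrow> eventually_quasipoly (\<lambda>n. f (n + s))"
  unfolding eventually_quasipoly_def by (blast intro: quasipoly_at_top_shift_up)

lemma eventually_quasipoly_shift_down:
  "eventually_quasipoly f \<Longrightarrow> eventually_quasipoly (\<lambda>n. f (n - s))"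
  unfolding eventually_quasipoly_def by (blast intro: quasipoly_at_top_shift_down)

text \<open>The step \<open>w\<close> need not match the period \<open>W\<close> of
  \<open>f\<close>. Iterating the equation \<open>W\<close> times gives the step
  \<open>w * W\<close>, which is also a period of the summed right-hand side.\<close>

lemma eventually_quasipoly_antidifference:
  assumes f: "eventually_quasipoly f" and "w > 0" and F: "\<And>n. F (n + w) = F n + f n"
  shows "eventually_quasipoly F"
proof -
  obtain W where W: "quasipoly_at_top W f" using f unfolding eventually_quasipoly_def by blast
  define V where "V = w * W"
  have V: "V > 0" using W \<open>w > 0\<close> by (simp add: V_def quasipoly_at_top_period_pos)
  have sum: "F (n + w * j) = F n + (\<Sum>i<j. f (n + w * i))" for n j
  proof (induction j)
    case (Suc j)
    then show ?case using F[of "n + w * j"] by (simp add: algebra_simps)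
  qed simp
  have "quasipoly_at_top V (\<lambda>n. \<Sum>i<W. f (n + w * i))"
    by (intro quasipoly_at_top_sum_same quasipoly_at_top_shift_up quasipoly_at_top_dvd[OF W])
       (use V in \<open>auto simp: V_def\<close>)
  then have "quasipoly_at_top V F"
    by (rule quasipoly_at_top_antidifference_same[where M = 0]) (simp add: V_def sum)
  then show ?thesis unfolding eventually_quasipoly_def ..
qed

lemma eventually_quasipoly_imp_quasipolynomial:
  assumes "eventually_quasipoly g"
  shows "\<exists>f. quasipolynomial f \<and> (\<exists>N. \<forall>n\<ge>N. g n = f (int n))"
proof -
  obtain W Q N where W: "W > 0" and Q: "\<And>n. n \<ge> N \<Longrightarrow> g n = poly (Q (n mod W)) (real n)"
    using assms unfolding eventually_quasipoly_def quasipoly_at_top_def by blast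
  \<comment> \<open>One degree bound for all residues; missing coefficients are 0.\<close>
  define d where "d = Max ((degree \<circ> Q) ` {..<W})"
  \<comment> \<open>Also for negative \<open>n\<close>, \<open>n mod int W\<close> is a residue
    between 0 and \<open>W - 1\<close>, so \<open>c i\<close> is periodic on all integers.\<close>
  define c where "c i n = coeff (Q (nat (n mod int W))) i" for i n
  define f where "f n = (\<Sum>i\<le>d. c i n * of_int n ^ i)" for n
  have "quasipolynomial f"
    unfolding quasipolynomial_def
  proof (intro exI conjI allI impI)
    show "0 < int W" using W by simp
    show "c i (n + int W) = c i n" for i n by (simp add: c_def)
  qed (rule f_def)
  moreover have "g n = f (int n)" if "n \<ge> N" for n
  proof -
    have "degree (Q (n mod W)) \<le> d"
      unfolding d_def by (rule Max_ge) (use W in auto)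
    then have "poly (Q (n mod W)) (real n) = (\<Sum>i\<le>d. coeff (Q (n mod W)) i * real n ^ i)"
      unfolding poly_altdef
      by (intro sum.mono_neutral_left) (auto simp: coeff_eq_0)
    then show ?thesis
      using that by (simp add: Q f_def c_def nat_int flip: of_nat_mod)
  qed
  ultimately show ?thesis by blast
qed

section \<open>Counting vectors by truncated coordinates and differences\<close>

text \<open>The value 0 off \<open>I\<close> makes a vector a function determined by its
  coordinates, and it is preserved by \<open>min\<close> and by truncated subtraction.\<close>

definition vectors :: "'i set \<Rightarrow> ('i \<Rightarrow> nat) set" where
  "vectors I = {a. \<forall>i. i \<notin> I \<longrightarrow> a i = 0}"

lemma vectorsD: "a \<in> vectors I \<Longrightarrow> i \<notin> I \<Longrightarrow> a i = 0"
  by (simp add: vectors_def)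

section \<open>Sets closed under decreasing large coordinates\<close>

text \<open>Go from \<open>a\<close> down to \<open>b\<close> by single decrements. A coordinate
  still to be lowered exceeds \<open>b i\<close>, which is at least \<open>m\<close>, so each
  decrement is allowed.\<close>

lemma decrement_closed_imp_shrink_closed:
  fixes X :: "('i \<Rightarrow> nat) set"
  assumes "finite I"
    and X: "\<And>a i. a \<in> vectors I \<Longrightarrow> i \<in> I \<Longrightarrow> a \<in> X \<Longrightarrow> m < a i \<Longrightarrow> a(i := a i - 1) \<in> X"
    and "a \<in> vectors I" "a \<in> X"
    and "\<And>i. b i \<le> a i" "\<And>i. b i < a i \<Longrightarrow> m \<le> b i"
  shows "b \<in> X"
  using assms(3-)
proof (induction "\<Sum>i\<in>I. a i - b i" arbitrary: a rule: less_induct)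
  case less
  show ?case
  proof (cases "\<exists>i. b i < a i")
    case True
    then obtain i where i: "b i < a i" by blast
    have I: "i \<in> I" using i less.prems(1) vectorsD by fastforce
    let ?a = "a(i := a i - 1)"
    show ?thesis
    proof (rule less.hyps)
      have "(\<Sum>j\<in>I - {i}. ?a j - b j) = (\<Sum>j\<in>I - {i}. a j - b j)"
        by (rule sum.cong) auto
      then show "(\<Sum>j\<in>I. ?a j - b j) < (\<Sum>j\<in>I. a j - b j)"
        using i I \<open>finite I\<close> by (simp add: sum.remove)
      show "?a \<in> vectors I"
        using less.prems(1) by (auto simp: vectors_def)
      have "m < a i" using less.prems(4)[OF i] i by simp
      then show "?a \<in> X"
        using X less.prems(1,2) I by blast
      show "b j \<le> ?a j" for j
        using less.prems(3) i by (auto simp: le_diff_conv Suc_leI)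
      show "m \<le> b j" if "b j < ?a j" for j
        using less.prems(4)[of j] that i by (auto split: if_splits)
    qed
  next
    case False
    then have "b = a" using less.prems(3) by (intro ext) (meson le_antisym not_less)
    then show ?thesis using less.prems(2) by simp
  qed
qed

text \<open>
  A set closed under decreasing coordinates above \<open>m\<close> is determined by its points with bounded
  coordinates. In the induction step the slices form a descending chain; its intersection is
  determined by a finite box, and the chain becomes constant as soon as it is constant on the box.
\<close>

lemma decrement_closed_imp_truncation_invariant:
  fixes X :: "('i \<Rightarrow> nat) set"
  assumes "finite I"
    and "\<And>a i. a \<in> vectors I \<Longrightarrow> i \<in> I \<Longrightarrow> a \<in> X \<Longrightarrow> m < a i \<Longrightarrow> a(i := a i - 1) \<in> X"
  shows "\<exists>M. \<forall>a\<in>vectors I. a \<in> X \<longleftrightarrow> (\<lambda>i. min (a i) M) \<in> X"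
  using assms
proof (induction I arbitrary: X rule: finite_induct)
  case empty
  have "(\<lambda>i. min (a i) 0) = a" if "a \<in> vectors {}" for a :: "'i \<Rightarrow> nat"
    using that by (auto simp: vectors_def)
  then show ?case by (intro exI[of _ 0]) simp
next
  case (insert i0 I)
  have shrink: "b \<in> X"
    if "a \<in> vectors (insert i0 I)" "a \<in> X" "\<And>i. b i \<le> a i" "\<And>i. b i < a i \<Longrightarrow> m \<le> b i" for a b
    by (rule decrement_closed_imp_shrink_closed[OF finite.insertI[OF insert.hyps(1)] insert.prems that])
  have upd: "a(i0 := v) \<in> vectors (insert i0 I)" if "a \<in> vectors I" for a v
    using that by (auto simp: vectors_def)
  define slice where "slice v = {a \<in> vectors I. a(i0 := v) \<in> X}" for v
  define core where "core = (\<Inter>v\<in>{m..}. slice v)"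
  have slice_closed: "a(i := a i - 1) \<in> slice v"
    if "a \<in> vectors I" "i \<in> I" "a \<in> slice v" "m < a i" for a i v
  proof -
    have "i \<noteq> i0" using that insert.hyps by auto
    then have "(a(i0 := v))(i := a i - 1) \<in> X"
      using insert.prems[OF upd[OF that(1)], of i v] that
      by (simp add: slice_def del: fun_upd_apply) simp
    then have "(a(i := a i - 1))(i0 := v) \<in> X"
      using \<open>i \<noteq> i0\<close> by (simp add: fun_upd_twist)
    moreover have "a(i := a i - 1) \<in> vectors I"
      using that by (auto simp: vectors_def)
    ultimately show ?thesis by (simp add: slice_def)
  qed
  have "\<forall>v. \<exists>M. \<forall>a\<in>vectors I. a \<in> slice v \<longleftrightarrow> (\<lambda>i. min (a i) M) \<in> slice v"
    by (intro allI insert.IH slice_closed)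
  from choice[OF this] obtain M
    where M: "\<And>v a. a \<in> vectors I \<Longrightarrow> a \<in> slice v \<longleftrightarrow> (\<lambda>i. min (a i) (M v)) \<in> slice v"
    by blast
  have core_closed: "a(i := a i - 1) \<in> core"
    if "a \<in> vectors I" "i \<in> I" "a \<in> core" "m < a i" for a i
    using slice_closed that by (auto simp: core_def)
  have "\<exists>L. \<forall>a\<in>vectors I. a \<in> core \<longleftrightarrow> (\<lambda>i. min (a i) L) \<in> core"
    by (intro insert.IH core_closed)
  then obtain L where L: "\<And>a. a \<in> vectors I \<Longrightarrow> a \<in> core \<longleftrightarrow> (\<lambda>i. min (a i) L) \<in> core"
    by blast
  have antimono: "slice w \<subseteq> slice v" if "m \<le> v" "v \<le> w" for v w
  proof
    fix a assume a: "a \<in> slice w"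
    have "a(i0 := v) \<in> X"
      by (rule shrink[of "a(i0 := w)"])
         (use a that upd in \<open>auto simp: slice_def split: if_splits\<close>)
    then show "a \<in> slice v" using a by (simp add: slice_def)
  qed
  \<comment> \<open>Cutting at \<open>L\<close> alone could lower a coordinate below
    \<open>m\<close>, where \<open>shrink\<close> does not apply.\<close>
  define L' where "L' = max L m"
  define box where "box = {a \<in> vectors I. \<forall>i. a i \<le> L'}"
  have "finite box"
  proof -
    have "box \<subseteq> {a. \<forall>i. (i \<in> I \<longrightarrow> a i \<in> {..L'}) \<and> (i \<notin> I \<longrightarrow> a i = 0)}"
      by (auto simp: box_def vectors_def)
    then show ?thesis
      using finite_set_of_finite_funs[OF insert.hyps(1), of "{..L'}" 0] finite_subset by blast
  qed
  have "\<exists>u\<ge>m. box \<inter> slice u \<subseteq> core"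
  proof -
    have "\<exists>u. u \<ge> m \<and> a \<notin> slice u" if "a \<in> box - core" for a
      using that by (auto simp: core_def)
    then obtain u where u: "\<And>a. a \<in> box - core \<Longrightarrow> u a \<ge> m \<and> a \<notin> slice (u a)" by metis
    \<comment> \<open>Each of the finitely many box points outside \<open>core\<close> has left the
      chain at some level. Inserting \<open>m\<close> makes the maximum meaningful and keeps it in
      the range where the slices decrease.\<close>
    define U where "U = Max (insert m (u ` (box - core)))"
    have fin: "finite (insert m (u ` (box - core)))" using \<open>finite box\<close> by simp
    have U: "U \<ge> m" "\<And>a. a \<in> box - core \<Longrightarrow> U \<ge> u a"
      unfolding U_def using fin by (auto intro: Max_ge)
    have "box \<inter> slice U \<subseteq> core"
    proof
      fix a assume a: "a \<in> box \<inter> slice U"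
      show "a \<in> core"
      proof (rule ccontr)
        assume "a \<notin> core"
        with a have "a \<in> box - core" by blast
        then show False using u U antimono a by blast
      qed
    qed
    with U show ?thesis by blast
  qed
  then obtain u where u: "u \<ge> m" "box \<inter> slice u \<subseteq> core" by blast
  have stable: "slice v = core" if "v \<ge> u" for v
  proof
    show "core \<subseteq> slice v" using that u by (auto simp: core_def)
    show "slice v \<subseteq> core"
    proof
      fix a assume "a \<in> slice v"
      then have a: "a \<in> vectors I" "a \<in> slice u"
        using antimono[OF u(1) that] by (auto simp: slice_def)
      let ?b = "\<lambda>i. min (a i) L'"
      have "?b(i0 := u) \<in> X"
        by (rule shrink[of "a(i0 := u)"])
           (use a upd in \<open>auto simp: slice_def L'_def split: if_splits\<close>)
      then have "?b \<in> box \<inter> slice u"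
        using a by (auto simp: box_def slice_def vectors_def)
      then have b: "?b \<in> vectors I" "?b \<in> core" using u(2) by (auto simp: box_def)
      have "(\<lambda>i. min (?b i) L) = (\<lambda>i. min (a i) L)" by (auto simp: L'_def)
      then show "a \<in> core" using L[OF a(1)] L[OF b(1)] b(2) by metis
    qed
  qed
  \<comment> \<open>Each of the finitely many slices up to \<open>u\<close> has its own bound
    \<open>M v\<close>, and all later ones equal \<open>core\<close> with bound \<open>L\<close>. As
    \<open>u \<le> N\<close>, cutting the coordinate \<open>i0\<close> at \<open>N\<close> does not
    change the slice either.\<close>
  define N where "N = Max (insert u (insert L (M ` {..u})))"
  have N: "u \<le> N" "L \<le> N" "\<And>v. v \<le> u \<Longrightarrow> M v \<le> N"
    unfolding N_def by (auto intro!: Max_ge simp del: Max_insert)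
  have slice_N: "a \<in> slice v \<longleftrightarrow> (\<lambda>i. min (a i) N) \<in> slice v" if "a \<in> vectors I" for a v
  proof -
    have b: "(\<lambda>i. min (a i) N) \<in> vectors I" using that by (auto simp: vectors_def)
    define K where "K = (if v \<le> u then M v else L)"
    have K: "a \<in> slice v \<longleftrightarrow> (\<lambda>i. min (a i) K) \<in> slice v" if "a \<in> vectors I" for a
      using M[OF that] L[OF that] stable[of v] by (auto simp: K_def)
    have "K \<le> N" using N by (simp add: K_def)
    then have "(\<lambda>i. min (min (a i) N) K) = (\<lambda>i. min (a i) K)" by auto
    then show ?thesis using K[OF that] K[OF b] by simp
  qed
  show ?case
  proof (intro exI[of _ N] ballI)
    fix a assume a: "a \<in> vectors (insert i0 I)"
    let ?a = "a(i0 := 0)"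
    have a': "?a \<in> vectors I" using a by (auto simp: vectors_def)
    have "slice (a i0) = slice (min (a i0) N)"
      using stable N(1) by (cases "a i0 \<le> N") auto
    then have "?a \<in> slice (a i0) \<longleftrightarrow> (\<lambda>i. min (?a i) N) \<in> slice (min (a i0) N)"
      using slice_N[OF a'] by simp
    moreover have "?a(i0 := a i0) = a" by simp
    moreover have "(\<lambda>i. min (?a i) N)(i0 := min (a i0) N) = (\<lambda>i. min (a i) N)" by auto
    moreover have "(\<lambda>i. min (?a i) N) \<in> vectors I" using a' by (auto simp: vectors_def)
    ultimately show "a \<in> X \<longleftrightarrow> (\<lambda>i. min (a i) N) \<in> X"
      using a' by (simp add: slice_def del: fun_upd_upd)
  qed
qed

section \<open>Vectors of a given sum that satisfy a condition on truncated differences\<close>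

definition vectors_of_sum :: "'i set \<Rightarrow> nat \<Rightarrow> ('i \<Rightarrow> nat) set" where
  "vectors_of_sum I n = {a \<in> vectors I. sum a I = n}"

lemma finite_vectors_of_sum:
  assumes "finite I"
  shows "finite (vectors_of_sum I n)"
proof -
  have "vectors_of_sum I n \<subseteq> {a. \<forall>i. (i \<in> I \<longrightarrow> a i \<in> {..n}) \<and> (i \<notin> I \<longrightarrow> a i = 0)}"
    using member_le_sum[OF _ _ assms] by (fastforce simp: vectors_of_sum_def vectors_def)
  then show ?thesis
    using finite_set_of_finite_funs[OF assms, of "{..n}" 0] finite_subset by blast
qed

text \<open>Both orders of \<open>i\<close> and \<open>j\<close> occur, so truncated subtraction
  records the signed difference cut off at absolute value \<open>M\<close>. The conditions are
  symmetric in \<open>a\<close> and \<open>b\<close>, hence one implication gives the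
  equivalence.\<close>

definition truncated_differences_invariant ::
    "'i set \<Rightarrow> nat \<Rightarrow> ('i \<Rightarrow> nat) set \<Rightarrow> bool" where
  "truncated_differences_invariant I M P \<longleftrightarrow>
     (\<forall>a\<in>vectors I. \<forall>b\<in>vectors I.
        (\<forall>i\<in>I. min (a i) M = min (b i) M) \<longrightarrow>
        (\<forall>i\<in>I. \<forall>j\<in>I. min (a i - a j) M = min (b i - b j) M) \<longrightarrow>
        a \<in> P \<longrightarrow> b \<in> P)"

lemma truncated_differences_invariantD:
  assumes "truncated_differences_invariant I M P" "a \<in> vectors I" "b \<in> vectors I"
    "\<And>i. i \<in> I \<Longrightarrow> min (a i) M = min (b i) M"
    "\<And>i j. i \<in> I \<Longrightarrow> j \<in> I \<Longrightarrow> min (a i - a j) M = min (b i - b j) M"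
  shows "a \<in> P \<longleftrightarrow> b \<in> P"
  using assms unfolding truncated_differences_invariant_def by metis

text \<open>
  Stratify by the minimum \<open>t\<close> and the set \<open>J\<close> of coordinates attaining it: subtracting \<open>t\<close> leaves
  a vector on \<open>I - J\<close>, which handles each \<open>t \<le> M\<close> by induction. Adding \<open>1\<close> to all coordinates
  preserves \<open>P\<close> once the minimum is at least \<open>M\<close>, which yields a difference equation for the rest.
\<close>

theorem eventually_quasipoly_card_truncated_differences_invariant:
  fixes P :: "('i \<Rightarrow> nat) set"
  assumes "finite I" "M > 0" "truncated_differences_invariant I M P"
  shows "eventually_quasipoly (\<lambda>n. real (card (vectors_of_sum I n \<inter> P)))"
  using assms(1,3)
proof (induction I arbitrary: P rule: finite_psubset_induct)
  case (psubset I)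
  note fin = psubset.hyps
  show ?case
  proof (cases "I = {}")
    case True
    show ?thesis
      \<comment> \<open>An empty sum is 0, so nothing is counted from \<open>n = 1\<close>
        on.\<close>
      by (rule eventually_quasipoly_cong[OF eventually_quasipoly_0, where M = 1])
         (auto simp: True vectors_of_sum_def)
  next
    case False
    then have "card I > 0" using fin by (simp add: card_gt_0_iff)
    define low where "low t n = {a \<in> vectors_of_sum I n \<inter> P. \<forall>i\<in>I. t \<le> a i}" for t n
    define stratum where
      "stratum t J n = {a \<in> vectors_of_sum I n \<inter> P. (\<forall>i\<in>J. a i = t) \<and> (\<forall>i\<in>I - J. t < a i)}" for t J n
    have fin_low: "finite (low t n)" and fin_stratum: "finite (stratum t J n)" for t J n
      using finite_vectors_of_sum[OF fin] by (auto simp: low_def stratum_def)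
    have stratum_eqp: "eventually_quasipoly (\<lambda>n. real (card (stratum t J n)))"
      if "t \<le> M" "J \<in> Pow I - {{}}" for t J
    proof -
      define lift where "lift b = (\<lambda>i. if i \<in> I then t + b i else 0)" for b :: "'i \<Rightarrow> nat"
      \<comment> \<open>Positivity on \<open>I - J\<close> says that the minimum is attained on
        \<open>J\<close> only. Since \<open>M > 0\<close>, truncation at \<open>M\<close> still
        detects it.\<close>
      define Q where "Q = {b. (\<forall>i\<in>I - J. 0 < b i) \<and> lift b \<in> P}"
      have J: "J \<subseteq> I" "I - J \<subset> I" using that by auto
      have "truncated_differences_invariant (I - J) M Q"
        unfolding truncated_differences_invariant_def
      proof (intro ballI impI)
        fix a b
        assume a: "a \<in> vectors (I - J)" and b: "b \<in> vectors (I - J)"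
          and ab: "\<forall>i\<in>I - J. min (a i) M = min (b i) M"
          and diff: "\<forall>i\<in>I - J. \<forall>j\<in>I - J. min (a i - a j) M = min (b i - b j) M"
          and aQ: "a \<in> Q"
        have ab': "min (a i) M = min (b i) M" for i
          using ab vectorsD[OF a, of i] vectorsD[OF b, of i] by (cases "i \<in> I - J") auto
        \<comment> \<open>Where one of the two entries vanishes, the difference is 0 or a
          coordinate, and truncated coordinates are already known to agree.\<close>
        have diff': "min (a i - a j) M = min (b i - b j) M" for i j
          using diff ab' vectorsD[OF a] vectorsD[OF b]
          by (cases "i \<in> I - J"; cases "j \<in> I - J") auto
        have "lift a \<in> P \<longleftrightarrow> lift b \<in> P"
        proof (rule truncated_differences_invariantD[OF psubset.prems])
          show "min (lift a i) M = min (lift b i) M" for i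
            using ab'[of i] by (auto simp: lift_def min_def split: if_splits)
          show "min (lift a i - lift a j) M = min (lift b i - lift b j) M" if "i \<in> I" "j \<in> I" for i j
            using diff'[of i j] that by (auto simp: lift_def)
        qed (auto simp: lift_def vectors_def)
        moreover have "0 < b i" if "i \<in> I - J" for i
        proof -
          have "0 < a i" using aQ that by (auto simp: Q_def)
          then show ?thesis using ab'[of i] \<open>M > 0\<close> by (simp add: min_def split: if_splits)
        qed
        ultimately show "b \<in> Q" using aQ by (auto simp: Q_def)
      qed
      then have eqp: "eventually_quasipoly (\<lambda>n. real (card (vectors_of_sum (I - J) (n - card I * t) \<inter> Q)))"
        by (intro eventually_quasipoly_shift_down psubset.IH J)
      have card_eq: "card (vectors_of_sum (I - J) (n - card I * t) \<inter> Q) = card (stratum t J n)"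
        if "n \<ge> card I * t" for n
      proof (rule bij_betw_same_card)
        have sum_lift: "sum (lift b) I = card I * t + sum b (I - J)" if "b \<in> vectors (I - J)" for b
        proof -
          have "sum (lift b) I = card I * t + sum b I" by (simp add: lift_def sum.distrib)
          also have "sum b I = sum b (I - J)"
            using J fin vectorsD[OF that] by (intro sum.mono_neutral_right) auto
          finally show ?thesis .
        qed
        show "bij_betw lift (vectors_of_sum (I - J) (n - card I * t) \<inter> Q) (stratum t J n)"
        proof (rule bij_betw_byWitness[where f' = "\<lambda>a i. a i - t"])
          show "\<forall>b\<in>vectors_of_sum (I - J) (n - card I * t) \<inter> Q. (\<lambda>i. lift b i - t) = b"
            by (auto simp: lift_def vectors_of_sum_def vectors_def)
          show lift': "\<forall>a\<in>stratum t J n. lift (\<lambda>i. a i - t) = a"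
          proof
            fix a assume a: "a \<in> stratum t J n"
            have "t \<le> a i" if "i \<in> I" for i
              using a that by (cases "i \<in> J") (auto simp: stratum_def dest!: less_imp_le)
            then show "lift (\<lambda>i. a i - t) = a"
              using a by (auto simp: lift_def stratum_def vectors_of_sum_def vectors_def)
          qed
          show "lift ` (vectors_of_sum (I - J) (n - card I * t) \<inter> Q) \<subseteq> stratum t J n"
            using sum_lift J that
            by (auto simp: stratum_def vectors_of_sum_def Q_def)
               (auto simp: lift_def vectors_def)
          show "(\<lambda>a i. a i - t) ` stratum t J n \<subseteq> vectors_of_sum (I - J) (n - card I * t) \<inter> Q"
          proof (rule image_subsetI)
            fix a assume a: "a \<in> stratum t J n"
            let ?b = "\<lambda>i. a i - t"
            have b: "?b \<in> vectors (I - J)"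
              using a by (auto simp: stratum_def vectors_of_sum_def vectors_def)
            have "card I * t + sum ?b (I - J) = n"
              using sum_lift[OF b] lift' a by (auto simp: stratum_def vectors_of_sum_def)
            then show "?b \<in> vectors_of_sum (I - J) (n - card I * t) \<inter> Q"
              using a b lift' by (auto simp: vectors_of_sum_def Q_def stratum_def)
          qed
        qed
      qed
      show ?thesis
        by (rule eventually_quasipoly_cong[OF eqp, where M = "card I * t"]) (simp add: card_eq)
    qed
    have low_split: "card (low t n) = card (low (Suc t) n) + (\<Sum>J\<in>Pow I - {{}}. card (stratum t J n))" for t n
    proof -
      have un: "low t n = low (Suc t) n \<union> (\<Union>J\<in>Pow I - {{}}. stratum t J n)"
      proof (intro equalityI subsetI)
        fix a assume a: "a \<in> low t n"
        show "a \<in> low (Suc t) n \<union> (\<Union>J\<in>Pow I - {{}}. stratum t J n)"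
        proof (cases "a \<in> low (Suc t) n")
          case False
          then obtain i where i: "i \<in> I" "\<not> Suc t \<le> a i" using a by (auto simp: low_def)
          then have "a i = t" using a by (auto simp: low_def intro: le_antisym)
          define J where "J = {i \<in> I. a i = t}"
          have "t < a i" if "i \<in> I - J" for i
            using a that by (auto simp: low_def J_def intro: le_neq_implies_less)
          then have "a \<in> stratum t J n"
            using a by (simp add: low_def stratum_def J_def)
          moreover have "J \<in> Pow I - {{}}" using i \<open>a i = t\<close> by (auto simp: J_def)
          ultimately show ?thesis by (intro UnI2 UN_I)
        qed simp
      next
        fix a assume "a \<in> low (Suc t) n \<union> (\<Union>J\<in>Pow I - {{}}. stratum t J n)"
        then show "a \<in> low t n"
          by (auto simp: low_def stratum_def Suc_le_eq) (metis DiffI less_imp_le order_refl)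
      qed
      have disj: "low (Suc t) n \<inter> (\<Union>J\<in>Pow I - {{}}. stratum t J n) = {}"
        by (fastforce simp: low_def stratum_def)
      have J: "J = {i \<in> I. a i = t}" if "a \<in> stratum t J n" "J \<subseteq> I" for a J
        using that by (auto simp: stratum_def)
      have "card (\<Union>J\<in>Pow I - {{}}. stratum t J n) = (\<Sum>J\<in>Pow I - {{}}. card (stratum t J n))"
      proof (rule card_UN_disjoint)
        show "\<forall>J\<in>Pow I - {{}}. \<forall>J'\<in>Pow I - {{}}. J \<noteq> J' \<longrightarrow> stratum t J n \<inter> stratum t J' n = {}"
        proof (intro ballI impI)
          fix J J' assume "J \<in> Pow I - {{}}" "J' \<in> Pow I - {{}}" "J \<noteq> J'"
          then have "\<not> (a \<in> stratum t J n \<and> a \<in> stratum t J' n)" for a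
            using J[of a J] J[of a J'] by auto
          then show "stratum t J n \<inter> stratum t J' n = {}" by blast
        qed
      qed (use fin fin_stratum in auto)
      then show ?thesis
        unfolding un using fin fin_low fin_stratum disj by (subst card_Un_disjoint) auto
    qed
    have strata_eqp: "eventually_quasipoly (\<lambda>n. \<Sum>J\<in>Pow I - {{}}. real (card (stratum t J n)))"
      if "t \<le> M" for t
      using fin stratum_eqp[OF that] by (intro eventually_quasipoly_sum) auto
    have "eventually_quasipoly (\<lambda>n. real (card (low M n)))"
    proof (rule eventually_quasipoly_antidifference[OF _ \<open>card I > 0\<close>])
      show "eventually_quasipoly (\<lambda>n. \<Sum>J\<in>Pow I - {{}}. real (card (stratum M J (n + card I))))"
        using eventually_quasipoly_shift_up[OF strata_eqp[of M]] by simp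
      fix n
      define up where "up a = (\<lambda>i. if i \<in> I then Suc (a i) else 0)" for a :: "'i \<Rightarrow> nat"
      have up_P: "up a \<in> P \<longleftrightarrow> a \<in> P" if "a \<in> vectors I" "\<forall>i\<in>I. M \<le> a i" for a
        by (rule truncated_differences_invariantD[OF psubset.prems])
           (use that in \<open>auto simp: up_def vectors_def\<close>)
      have sum_up: "sum (up a) I = sum a I + card I" for a
        by (simp add: up_def sum_Suc)
      have "bij_betw up (low M n) (low (Suc M) (n + card I))"
      proof (rule bij_betw_byWitness[where f' = "\<lambda>a i. a i - 1"])
        show "\<forall>a\<in>low M n. (\<lambda>i. up a i - 1) = a"
          by (auto simp: up_def low_def vectors_of_sum_def vectors_def)
        show up': "\<forall>a\<in>low (Suc M) (n + card I). up (\<lambda>i. a i - 1) = a"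
          by (fastforce simp: up_def low_def vectors_of_sum_def vectors_def)
        show "up ` low M n \<subseteq> low (Suc M) (n + card I)"
          using sum_up up_P by (auto simp: low_def vectors_of_sum_def) (auto simp: up_def vectors_def)
        show "(\<lambda>a i. a i - 1) ` low (Suc M) (n + card I) \<subseteq> low M n"
        proof (rule image_subsetI)
          fix a assume a: "a \<in> low (Suc M) (n + card I)"
          let ?b = "\<lambda>i. a i - 1"
          have b: "?b \<in> vectors I" "\<forall>i\<in>I. M \<le> ?b i"
            using a by (auto simp: low_def vectors_of_sum_def vectors_def le_diff_conv2)
          moreover have "up ?b = a" using up' a by blast
          ultimately show "?b \<in> low M n"
            using a up_P[OF b] sum_up[of ?b] by (auto simp: low_def vectors_of_sum_def)
        qed
      qed
      then have "card (low M n) = card (low (Suc M) (n + card I))"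
        by (rule bij_betw_same_card)
      then show "real (card (low M (n + card I))) =
          real (card (low M n)) + (\<Sum>J\<in>Pow I - {{}}. real (card (stratum M J (n + card I))))"
        by (simp add: low_split[of M "n + card I"])
    qed
    moreover have "eventually_quasipoly (\<lambda>n. real (card (low t n)))"
      if "eventually_quasipoly (\<lambda>n. real (card (low (Suc t) n)))" "t < M" for t
      using eventually_quasipoly_add[OF that(1) strata_eqp[of t]] that(2)
      by (simp add: low_split[of t])
    ultimately have "eventually_quasipoly (\<lambda>n. real (card (low 0 n)))"
      by (intro inc_induct[of 0 M "\<lambda>t. eventually_quasipoly (\<lambda>n. real (card (low t n)))"]) auto
    then show ?thesis by (simp add: low_def Collect_conj_eq)
  qed
qed

section \<open>Orbits of a model functor\<close>

text \<open>Each fibre of \<open>f\<close> on \<open>V\<close> is finite and has exactly one least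
  element. Totality is asked on \<open>V\<close> only, because \<open>less_fun\<close> is sure to
  compare two functions only if they differ at finitely many places.\<close>

lemma card_image_eq_card_minimal:
  fixes lt :: "'a \<Rightarrow> 'a \<Rightarrow> bool" and f :: "'a \<Rightarrow> 'b"
  assumes "finite V" and "asymp lt" "transp lt"
    and total: "\<And>a b. a \<in> V \<Longrightarrow> b \<in> V \<Longrightarrow> lt a b \<or> a = b \<or> lt b a"
  shows "card (f ` V) = card {a \<in> V. \<forall>b\<in>V. f b = f a \<longrightarrow> \<not> lt b a}"
proof (rule sym, rule bij_betw_same_card)
  show "bij_betw f {a \<in> V. \<forall>b\<in>V. f b = f a \<longrightarrow> \<not> lt b a} (f ` V)"
  proof (rule bij_betw_imageI)
    show "inj_on f {a \<in> V. \<forall>b\<in>V. f b = f a \<longrightarrow> \<not> lt b a}"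
      using total by (auto simp: inj_on_def) metis
    have "f a \<in> f ` {a \<in> V. \<forall>b\<in>V. f b = f a \<longrightarrow> \<not> lt b a}" if "a \<in> V" for a
    proof -
      let ?C = "{b \<in> V. f b = f a}"
      have "\<exists>m\<in>?C. \<forall>b\<in>?C. b \<noteq> m \<longrightarrow> \<not> lt b m"
        using assms that
        by (intro Finite_Set.bex_min_element) (auto intro: asymp_on_subset[OF assms(2)] transp_on_subset[OF assms(3)])
      then obtain m where m: "m \<in> ?C" "\<forall>b\<in>?C. b \<noteq> m \<longrightarrow> \<not> lt b m" by blast
      moreover have "\<not> lt m m" using \<open>asymp lt\<close> by (auto dest: asympD)
      ultimately have "m \<in> {a \<in> V. \<forall>b\<in>V. f b = f a \<longrightarrow> \<not> lt b a}" "f a = f m" by auto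
      then show ?thesis by blast
    qed
    then show "f ` {a \<in> V. \<forall>b\<in>V. f b = f a \<longrightarrow> \<not> lt b a} = f ` V" by blast
  qed
qed

text \<open>The complements of \<open>D\<close> and of its image in \<open>I\<close> have equal
  size, so any bijection between them completes \<open>f\<close>.\<close>

lemma inj_on_extends_to_permutation:
  assumes "finite I" "D \<subseteq> I" "inj_on f D" "f ` D \<subseteq> I"
  shows "\<exists>\<rho>. \<rho> permutes I \<and> (\<forall>x\<in>D. \<rho> x = f x)"
proof -
  have "card (I - D) = card (I - f ` D)"
    using assms by (simp add: card_Diff_subset finite_subset card_image)
  then obtain g where g: "bij_betw g (I - D) (I - f ` D)"
    using assms(1) by (metis finite_Diff finite_same_card_bij)
  define \<rho> where "\<rho> x = (if x \<in> D then f x else if x \<in> I then g x else x)" for x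
  have "bij_betw \<rho> D (f ` D)"
    using assms(3) by (auto simp: bij_betw_def inj_on_def \<rho>_def)
  moreover have "bij_betw \<rho> (I - D) (I - f ` D)"
    using g by (subst bij_betw_cong[of _ _ g]) (auto simp: \<rho>_def)
  ultimately have "bij_betw \<rho> (D \<union> (I - D)) (f ` D \<union> (I - f ` D))"
    by (rule bij_betw_combine) auto
  moreover have "D \<union> (I - D) = I" "f ` D \<union> (I - f ` D) = I" using assms by auto
  ultimately have "bij_betw \<rho> I I" by simp
  then have "\<rho> permutes I"
    using assms(2) by (intro bij_imp_permutes) (auto simp: \<rho>_def)
  then show ?thesis by (auto simp: \<rho>_def)
qed

context model_functor
begin

section \<open>Elements of the functor and their colour counts\<close>

abbreviation F :: "nat set \<Rightarrow> 's elt set" where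
  "F \<equiv> F_obj S0 E"

definition colour_count :: "nat set \<Rightarrow> 's elt \<Rightarrow> nat \<Rightarrow> nat" where
  "colour_count S x c = card {i \<in> S - fst x ` S0. snd x i = c}"

lemma F_objD:
  assumes "x \<in> F S" "finite S"
  shows "fst x \<in> S0 \<rightarrow>\<^sub>E S" "inj_on (fst x) S0" "snd x \<in> E (S - fst x ` S0)"
    "snd x \<in> (S - fst x ` S0) \<rightarrow>\<^sub>E {1..k}" "fst x ` S0 \<subseteq> S"
proof -
  show x: "fst x \<in> S0 \<rightarrow>\<^sub>E S" "inj_on (fst x) S0" "snd x \<in> E (S - fst x ` S0)"
    using assms(1) by (auto simp: F_obj_def)
  show "snd x \<in> (S - fst x ` S0) \<rightarrow>\<^sub>E {1..k}"
    using E_subset[of "S - fst x ` S0"] assms(2) x(3) by blast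
  show "fst x ` S0 \<subseteq> S" using x(1) by auto
qed

lemma R_imp_F:
  assumes "(x, y) \<in> R S" "finite S"
  shows "x \<in> F S" "y \<in> F S"
  using assms equiv_R[of S] by (auto simp: equiv_def refl_on_def)

lemma R_refl: "finite S \<Longrightarrow> x \<in> F S \<Longrightarrow> (x, x) \<in> R S"
  using equiv_R[of S] by (auto simp: equiv_def refl_on_def)

lemma R_sym: "finite S \<Longrightarrow> (x, y) \<in> R S \<Longrightarrow> (y, x) \<in> R S"
  using equiv_R[of S] by (meson equivE symD)

lemma colour_count_in_vectors_of_sum:
  assumes "x \<in> F S" "finite S"
  shows "colour_count S x \<in> vectors_of_sum {1..k} (card S - card S0)" "card S0 \<le> card S"
proof -
  note x = F_objD[OF assms]
  let ?U = "S - fst x ` S0"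
  have card_im: "card (fst x ` S0) = card S0" using x by (simp add: card_image)
  show "card S0 \<le> card S"
    using card_mono[OF assms(2) x(5)] card_im by simp
  have "sum (colour_count S x) {1..k} = (\<Sum>c\<in>{1..k}. sum (\<lambda>_. 1) {i \<in> ?U. snd x i = c})"
    by (simp add: colour_count_def)
  also have "\<dots> = sum (\<lambda>_. 1) ?U"
    by (rule sum.group) (use x assms in auto)
  also have "\<dots> = card S - card S0"
    using x assms card_im by (simp add: card_Diff_subset finite_subset)
  finally have "sum (colour_count S x) {1..k} = card S - card S0" .
  moreover have "colour_count S x c = 0" if "c \<notin> {1..k}" for c
  proof -
    have "{i \<in> ?U. snd x i = c} = {}" using x(4) that by (auto simp: PiE_iff)
    then show ?thesis by (simp only: colour_count_def card.empty)
  qed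
  ultimately show "colour_count S x \<in> vectors_of_sum {1..k} (card S - card S0)"
    by (simp add: vectors_of_sum_def vectors_def)
qed

lemma colour_count_in_vectors: "x \<in> F S \<Longrightarrow> finite S \<Longrightarrow> colour_count S x \<in> vectors {1..k}"
  using colour_count_in_vectors_of_sum(1) by (auto simp: vectors_of_sum_def)

section \<open>Transport along bijections\<close>

text \<open>For a bijection \<open>p\<close> from \<open>S\<close> to \<open>T\<close>,
  \<open>x \<in> F T\<close> and \<open>y \<in> F S\<close>, this is
  \<open>F_map S0 S p x = Some y\<close> stated without an inverse map.\<close>

definition corresponds :: "(nat \<Rightarrow> nat) \<Rightarrow> nat set \<Rightarrow> 's elt \<Rightarrow> 's elt \<Rightarrow> bool" where
  "corresponds p S x y \<longleftrightarrow>
     (\<forall>s\<in>S0. p (fst y s) = fst x s) \<and> (\<forall>i\<in>S - fst y ` S0. snd y i = snd x (p i))"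

lemma corresponds_unique:
  assumes "inj_on p S" "finite S" "y \<in> F S" "y' \<in> F S" "corresponds p S x y" "corresponds p S x y'"
  shows "y = y'"
proof -
  note y = F_objD[OF assms(3,2)] and y' = F_objD[OF assms(4,2)]
  have "fst y = fst y'"
  proof (rule PiE_ext[OF y(1) y'(1)])
    fix s assume s: "s \<in> S0"
    then have "p (fst y s) = p (fst y' s)" using assms(5,6) by (simp add: corresponds_def)
    then show "fst y s = fst y' s"
      using assms(1) s y(5) y'(5) by (auto dest: inj_onD)
  qed
  moreover from this have "snd y = snd y'"
    using assms(5,6) y'(4) by (intro PiE_ext[OF y(4)]) (auto simp: corresponds_def)
  ultimately show ?thesis by (rule prod_eqI)
qed

lemma corresponds_image:
  assumes "corresponds p S x y" "bij_betw p S T" "y \<in> F S" "finite S"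
  shows "p ` (fst y ` S0) = fst x ` S0" "bij_betw p (S - fst y ` S0) (T - fst x ` S0)"
proof -
  show *: "p ` (fst y ` S0) = fst x ` S0"
    using assms(1) by (auto simp: corresponds_def image_iff)
  show "bij_betw p (S - fst y ` S0) (T - fst x ` S0)"
    unfolding *[symmetric] using assms(2) F_objD(5)[OF assms(3,4)]
    by (auto simp: bij_betw_def inj_on_def)
qed

text \<open>A bijection covers the image of every injection, so the partial map is total here. The
  new colouring is allowed by \<open>E_closed\<close>, applied to \<open>p\<close> between the
  complements of the two images.\<close>

lemma F_map_corresponds:
  assumes p: "bij_betw p S T" and fin: "finite S" "finite T" and x: "x \<in> F T"
  obtains y where "y \<in> F S" "F_map S0 S p x = Some y" "corresponds p S x y"
proof -
  obtain \<sigma> \<alpha> where x_eq: "x = (\<sigma>, \<alpha>)" by force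
  note xD = F_objD[OF x fin(2), unfolded x_eq fst_conv snd_conv]
  let ?q = "inv_into S p"
  have pS: "p ` S = T" and inj: "inj_on p S" using p by (auto simp: bij_betw_def)
  define \<sigma>' where "\<sigma>' = compose S0 ?q \<sigma>"
  define y where "y = (\<sigma>', compose (S - \<sigma>' ` S0) \<alpha> p)"
  have p\<sigma>': "p (\<sigma>' s) = \<sigma> s" "\<sigma>' s \<in> S" if "s \<in> S0" for s
    using that xD(5) pS by (auto simp: \<sigma>'_def compose_def intro!: f_inv_into_f inv_into_into)
  have "corresponds p S x y"
    using p\<sigma>' by (simp add: corresponds_def y_def x_eq compose_def)
  moreover have "F_map S0 S p x = Some y"
    using xD(5) pS by (simp add: F_map_def x_eq y_def \<sigma>'_def Let_def)
  moreover have "y \<in> F S"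
  proof -
    have "inj_on \<sigma>' S0"
    proof (rule inj_onI)
      fix s t assume "s \<in> S0" "t \<in> S0" "\<sigma>' s = \<sigma>' t"
      then have "\<sigma> s = \<sigma> t" using p\<sigma>'(1) by metis
      then show "s = t" using xD(2) \<open>s \<in> S0\<close> \<open>t \<in> S0\<close> by (auto dest: inj_onD)
    qed
    moreover have "\<sigma>' \<in> S0 \<rightarrow>\<^sub>E S" using p\<sigma>' by (auto simp: \<sigma>'_def compose_def)
    moreover have "p \<in> injections (S - \<sigma>' ` S0) (T - \<sigma> ` S0)"
    proof -
      have "p i \<notin> \<sigma> ` S0" if "i \<in> S - \<sigma>' ` S0" for i
      proof
        assume "p i \<in> \<sigma> ` S0"
        then obtain s where "s \<in> S0" "p i = p (\<sigma>' s)" using p\<sigma>' by auto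
        then show False using that inj p\<sigma>'(2) by (auto dest: inj_onD)
      qed
      then show ?thesis using inj pS by (auto simp: injections_def inj_on_def)
    qed
    then have "compose (S - \<sigma>' ` S0) \<alpha> p \<in> E (S - \<sigma>' ` S0)"
      using E_closed xD(3) fin by blast
    ultimately show ?thesis by (simp add: F_obj_def y_def)
  qed
  ultimately show thesis using that by blast
qed

lemma corresponds_imp_F_map:
  assumes "bij_betw p S T" "finite S" "finite T" "x \<in> F T" "y \<in> F S" "corresponds p S x y"
  shows "F_map S0 S p x = Some y"
proof -
  obtain y' where "y' \<in> F S" "F_map S0 S p x = Some y'" "corresponds p S x y'"
    using F_map_corresponds assms by blast
  then show ?thesis
    using corresponds_unique[of p S y y' x] assms by (auto simp: bij_betw_def)
qed

lemma corresponds_colour_count: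
  assumes "bij_betw p S T" "finite S" "y \<in> F S" "corresponds p S x y"
  shows "colour_count S y = colour_count T x"
proof
  fix c
  note p = corresponds_image(2)[OF assms(4,1,3,2)]
  have "bij_betw p {i \<in> S - fst y ` S0. snd y i = c} {j \<in> T - fst x ` S0. snd x j = c}"
  proof (rule bij_betw_imageI)
    show "inj_on p {i \<in> S - fst y ` S0. snd y i = c}"
      using p by (auto simp: bij_betw_def intro: inj_on_subset)
    have "{j \<in> T - fst x ` S0. snd x j = c} = {j \<in> p ` (S - fst y ` S0). snd x j = c}"
      using p by (simp add: bij_betw_def)
    then show "p ` {i \<in> S - fst y ` S0. snd y i = c} = {j \<in> T - fst x ` S0. snd x j = c}"
      using assms(4) by (auto simp: corresponds_def)
  qed
  then show "colour_count S y c = colour_count T x c"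
    unfolding colour_count_def by (rule bij_betw_same_card)
qed

text \<open>On the image of \<open>fst y\<close> the bijection is forced by the two injections;
  elsewhere glue one bijection for each colour, which exists because the counts agree.\<close>

lemma colour_count_eq_imp_corresponds:
  assumes fin: "finite S" "finite T" and x: "x \<in> F T" and y: "y \<in> F S"
    and eq: "colour_count S y = colour_count T x"
  obtains p where "bij_betw p S T" "corresponds p S x y"
proof -
  note xD = F_objD[OF x fin(2)] and yD = F_objD[OF y fin(1)]
  let ?U = "\<lambda>c. {i \<in> S - fst y ` S0. snd y i = c}" and ?W = "\<lambda>c. {j \<in> T - fst x ` S0. snd x j = c}"
  have "\<exists>g. bij_betw g (?U c) (?W c)" for c
    using fun_cong[OF eq, of c] fin by (intro finite_same_card_bij) (auto simp: colour_count_def)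
  then have "\<forall>c. \<exists>g. bij_betw g (?U c) (?W c)" ..
  from choice[OF this] obtain g where g: "\<And>c. bij_betw (g c) (?U c) (?W c)" by blast
  define p where "p i = (if i \<in> fst y ` S0 then fst x (inv_into S0 (fst y) i) else g (snd y i) i)" for i
  have p1: "p (fst y s) = fst x s" if "s \<in> S0" for s
    using that yD(2) by (simp add: p_def)
  have p2: "p i \<in> ?W (snd y i)" if "i \<in> S - fst y ` S0" for i
    using that bij_betwE[OF g[of "snd y i"]] by (simp add: p_def)
  have "bij_betw p (fst y ` S0) (fst x ` S0)"
    using p1 xD(2) by (auto simp: bij_betw_def inj_on_def image_image)
  moreover have "bij_betw p (S - fst y ` S0) (T - fst x ` S0)"
    unfolding bij_betw_def
  proof
    show "inj_on p (S - fst y ` S0)"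
    proof (rule inj_onI)
      fix i j assume i: "i \<in> S - fst y ` S0" and j: "j \<in> S - fst y ` S0" and ij: "p i = p j"
      then have c: "snd y i = snd y j" using p2[OF i] p2[OF j] by auto
      then have "g (snd y i) i = g (snd y i) j" using i j ij by (simp add: p_def)
      then show "i = j"
        using g[of "snd y i"] i j c by (auto simp: bij_betw_def dest: inj_onD)
    qed
    show "p ` (S - fst y ` S0) = T - fst x ` S0"
    proof
      show "p ` (S - fst y ` S0) \<subseteq> T - fst x ` S0" using p2 by auto
      show "T - fst x ` S0 \<subseteq> p ` (S - fst y ` S0)"
      proof
        fix j assume "j \<in> T - fst x ` S0"
        then have "j \<in> g (snd x j) ` ?U (snd x j)"
          using g[of "snd x j"] by (auto simp: bij_betw_def)
        then obtain i where "i \<in> ?U (snd x j)" "j = g (snd x j) i" by blast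
        then have "i \<in> S - fst y ` S0" "j = p i" by (auto simp: p_def)
        then show "j \<in> p ` (S - fst y ` S0)" by blast
      qed
    qed
  qed
  ultimately have "bij_betw p (fst y ` S0 \<union> (S - fst y ` S0)) (fst x ` S0 \<union> (T - fst x ` S0))"
    by (rule bij_betw_combine) auto
  moreover have "fst y ` S0 \<union> (S - fst y ` S0) = S" "fst x ` S0 \<union> (T - fst x ` S0) = T"
    using xD(5) yD(5) by auto
  ultimately have "bij_betw p S T" by simp
  moreover have "corresponds p S x y"
    using p1 p2 by (auto simp: corresponds_def)
  ultimately show thesis using that by blast
qed

lemma R_transport_F_map:
  assumes p: "bij_betw p S T" and fin: "finite S" "finite T" and R: "(x, x') \<in> R T"
    and "F_map S0 S p x = Some y" "F_map S0 S p x' = Some y'"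
  shows "(y, y') \<in> R S"
proof -
  have "x \<in> F T" "x' \<in> F T" using R_imp_F[OF R fin(2)] .
  then have im: "fst x ` S0 \<union> fst x' ` S0 \<subseteq> p ` S"
    using F_objD(5) fin p by (auto simp: bij_betw_def)
  have "p \<in> injections S T" using p by (auto simp: bij_betw_def injections_def)
  then show ?thesis
    using axiom1[of S T p "fst x" "snd x" "fst x'" "snd x'"] assms im by simp
qed

text \<open>Which counts are related to a given one depends neither on the element having that count
  nor on the underlying set: carry the equivalent pair along a bijection that takes \<open>x\<close>
  to \<open>y\<close>.\<close>

lemma R_transport:
  assumes fin: "finite S" "finite T" and R: "(x, x') \<in> R T" and y: "y \<in> F S"
    and eq: "colour_count S y = colour_count T x"
  obtains y' where "(y, y') \<in> R S" "colour_count S y' = colour_count T x'"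
proof -
  have x: "x \<in> F T" "x' \<in> F T" using R_imp_F[OF R fin(2)] .
  obtain p where p: "bij_betw p S T" "corresponds p S x y"
    using colour_count_eq_imp_corresponds[OF fin x(1) y eq] .
  obtain y' where y': "y' \<in> F S" "F_map S0 S p x' = Some y'" "corresponds p S x' y'"
    using F_map_corresponds[OF p(1) fin x(2)] .
  have "(y, y') \<in> R S"
    using R_transport_F_map[OF p(1) fin R] corresponds_imp_F_map[OF p(1) fin x(1) y p(2)] y'(2)
    by blast
  then show thesis
    using that corresponds_colour_count[OF p(1) fin(1) y'(1,3)] by blast
qed

section \<open>Orbits as sets of classes with a common count\<close>

definition classes_of_count :: "nat set \<Rightarrow> (nat \<Rightarrow> nat) \<Rightarrow> 's elt set set" where
  "classes_of_count S a = (\<lambda>y. R S `` {y}) ` {y \<in> F S. colour_count S y = a}"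

text \<open>\<open>model_map\<close> collects the images of all representatives; by
  \<open>axiom1\<close> these are equivalent to the image \<open>y\<close> of the chosen
  one.\<close>

lemma sym_action_class:
  assumes x: "x \<in> F {1..n}" and p: "p permutes {1..n}"
    and y: "F_map S0 {1..n} (inv' p) x = Some y"
  shows "sym_action S0 E R n p (R {1..n} `` {x}) = R {1..n} `` {y}"
proof -
  let ?S = "{1..n}" and ?q = "inv' p"
  have q: "bij_betw ?q ?S ?S" using permutes_inv[OF p] by (rule permutes_imp_bij)
  let ?D = "{v. \<exists>u\<in>R ?S `` {x}. F_map S0 ?S ?q u = Some v}"
  have y_D: "y \<in> ?D" using y R_refl[of ?S x] x by auto
  have D: "(y, v) \<in> R ?S" if v: "v \<in> ?D" for v
  proof -
    obtain u where "(x, u) \<in> R ?S" "F_map S0 ?S ?q u = Some v" using v by blast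
    then show ?thesis using R_transport_F_map[OF q _ _ _ y] by blast
  qed
  have "(y, y) \<in> R ?S" using D[OF y_D] .
  have "R ?S `` ?D = R ?S `` {y}"
  proof
    show "R ?S `` {y} \<subseteq> R ?S `` ?D" using y_D by blast
    show "R ?S `` ?D \<subseteq> R ?S `` {y}"
      using D equiv_R[of ?S] by (auto simp: equiv_def dest: transD)
  qed
  moreover have "R ?S `` {x} \<in> model_obj S0 E R ?S"
    using x by (simp add: model_obj_def quotientI)
  moreover have "?D \<noteq> {}" using y_D by blast
  ultimately show ?thesis by (simp only: sym_action_def model_map_def Let_def restrict_apply if_True if_False option.sel)
qed

text \<open>Permutations preserve counts, and two elements of \<open>F {1..n}\<close> with equal
  counts are joined by a permutation.\<close>

lemma orbit_class:
  assumes x: "x \<in> F {1..n}"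
  shows "orbit (sym_group n) (sym_action S0 E R n) (R {1..n} `` {x})
      = classes_of_count {1..n} (colour_count {1..n} x)"
proof
  let ?S = "{1..n}"
  show "orbit (sym_group n) (sym_action S0 E R n) (R ?S `` {x}) \<subseteq> classes_of_count ?S (colour_count ?S x)"
  proof
    fix C assume "C \<in> orbit (sym_group n) (sym_action S0 E R n) (R ?S `` {x})"
    then obtain p where p: "p permutes ?S" and C: "C = sym_action S0 E R n p (R ?S `` {x})"
      by (auto simp: orbit_def sym_group_def)
    have q: "bij_betw (inv' p) ?S ?S" using permutes_inv[OF p] by (rule permutes_imp_bij)
    obtain y where y: "y \<in> F ?S" "F_map S0 ?S (inv' p) x = Some y" "corresponds (inv' p) ?S x y"
      using F_map_corresponds[OF q _ _ x] by auto
    have "C = R ?S `` {y}" using sym_action_class[OF x p y(2)] C by simp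
    then show "C \<in> classes_of_count ?S (colour_count ?S x)"
      using y corresponds_colour_count[OF q _ y(1,3)] by (auto simp: classes_of_count_def)
  qed
  show "classes_of_count ?S (colour_count ?S x) \<subseteq> orbit (sym_group n) (sym_action S0 E R n) (R ?S `` {x})"
  proof
    fix C assume "C \<in> classes_of_count ?S (colour_count ?S x)"
    then obtain y where y: "y \<in> F ?S" "colour_count ?S y = colour_count ?S x" "C = R ?S `` {y}"
      by (auto simp: classes_of_count_def)
    obtain q where q: "bij_betw q ?S ?S" "corresponds q ?S x y"
      using colour_count_eq_imp_corresponds[OF _ _ x y(1,2)] by auto
    \<comment> \<open>\<open>permutes\<close> demands the identity outside
      \<open>{1..n}\<close>.\<close>
    define q' where "q' i = (if i \<in> ?S then q i else i)" for i
    have q'_bij: "bij_betw q' ?S ?S"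
      using q(1) by (subst bij_betw_cong[of _ _ q]) (auto simp: q'_def)
    then have q': "q' permutes ?S" by (rule bij_imp_permutes) (auto simp: q'_def)
    have "corresponds q' ?S x y"
      using q(2) F_objD(5)[OF y(1)] by (auto simp: corresponds_def q'_def image_subset_iff)
    then have "F_map S0 ?S q' x = Some y"
      using corresponds_imp_F_map[OF q'_bij _ _ x y(1)] by simp
    \<comment> \<open>\<open>sym_action\<close> inverts its argument, so the element that acts
      through \<open>q'\<close> is \<open>inv' q'\<close>.\<close>
    then have "C = sym_action S0 E R n (inv' q') (R ?S `` {x})"
      using sym_action_class[OF x permutes_inv[OF q']] y(3) by (simp add: permutes_inv_inv[OF q'])
    then show "C \<in> orbit (sym_group n) (sym_action S0 E R n) (R ?S `` {x})"
      using permutes_inv[OF q'] by (auto simp: orbit_def sym_group_def)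
  qed
qed

lemma orbits_eq_image:
  "orbits (sym_group n) (model_obj S0 E R {1..n}) (sym_action S0 E R n)
     = classes_of_count {1..n} ` (colour_count {1..n} ` F {1..n})"
proof -
  have "model_obj S0 E R {1..n} = (\<lambda>x. R {1..n} `` {x}) ` F {1..n}"
    by (auto simp: model_obj_def quotient_def)
  then have "orbits (sym_group n) (model_obj S0 E R {1..n}) (sym_action S0 E R n)
      = (\<lambda>x. orbit (sym_group n) (sym_action S0 E R n) (R {1..n} `` {x})) ` F {1..n}"
    by (simp add: orbits_def Setcompr_eq_image image_image)
  also have "\<dots> = (\<lambda>x. classes_of_count {1..n} (colour_count {1..n} x)) ` F {1..n}"
    by (rule image_cong[OF refl orbit_class])
  finally show ?thesis by (simp add: image_image)
qed

text \<open>One shared class is enough: \<open>R_transport\<close> then gives every element with the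
  first count an equivalent element with the second, and conversely.\<close>

lemma classes_of_count_eq_iff:
  assumes "finite S" "x \<in> F S"
  shows "classes_of_count S (colour_count S x) = classes_of_count S b \<longleftrightarrow>
    (\<exists>y. (x, y) \<in> R S \<and> colour_count S y = b)"
proof
  assume "classes_of_count S (colour_count S x) = classes_of_count S b"
  then have "R S `` {x} \<in> classes_of_count S b"
    using assms(2) by (auto simp: classes_of_count_def)
  then obtain y where "y \<in> F S" "colour_count S y = b" "R S `` {x} = R S `` {y}"
    by (auto simp: classes_of_count_def)
  then show "\<exists>y. (x, y) \<in> R S \<and> colour_count S y = b"
    using eq_equiv_class[OF _ equiv_R] assms(1) by blast
next
  have sub: "classes_of_count S (colour_count S u) \<subseteq> classes_of_count S (colour_count S v)"
    if uv: "(u, v) \<in> R S" for u v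
  proof
    fix C assume "C \<in> classes_of_count S (colour_count S u)"
    then obtain y where y: "y \<in> F S" "colour_count S y = colour_count S u" "C = R S `` {y}"
      by (auto simp: classes_of_count_def)
    obtain y' where y': "(y, y') \<in> R S" "colour_count S y' = colour_count S v"
      using R_transport[OF assms(1) assms(1) uv y(1,2)] .
    then have "C = R S `` {y'}"
      using y(3) equiv_class_eq[OF equiv_R] assms(1) by blast
    then show "C \<in> classes_of_count S (colour_count S v)"
      using y' R_imp_F(2)[OF y'(1) assms(1)] by (auto simp: classes_of_count_def)
  qed
  assume "\<exists>y. (x, y) \<in> R S \<and> colour_count S y = b"
  then show "classes_of_count S (colour_count S x) = classes_of_count S b"
    using sub R_sym[OF assms(1)] by (metis subset_antisym)
qed

section \<open>Matching the colours of equivalent elements\<close>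

text \<open>
  By \<open>axiom3\<close>, equivalent elements have the same colours outside the images of the two
  injections, up to a permutation \<open>\<rho>\<close>; the counts of matching colours differ by a bounded \<open>\<delta>\<close>.
\<close>

definition match_witness ::
    "(nat \<Rightarrow> nat) \<Rightarrow> (nat \<Rightarrow> int) \<Rightarrow> nat set \<Rightarrow> 's elt \<Rightarrow> 's elt \<Rightarrow> bool" where
  "match_witness \<rho> \<delta> S x x' \<longleftrightarrow> finite S \<and> (x, x') \<in> R S \<and>
     (\<forall>c\<in>{1..k}. int (colour_count S x' c) = int (colour_count S x (\<rho> c)) + \<delta> c) \<and>
     (\<forall>i\<in>S - (fst x ` S0 \<union> fst x' ` S0). snd x i = \<rho> (snd x' i))"

text \<open>\<open>S\<close> ranges over all finite sets, so that deleting a point does not leave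
  the realm of the definition. The size of \<open>S\<close> is recovered from the coordinate
  sum.\<close>

definition matched_counts :: "(nat \<Rightarrow> nat) \<Rightarrow> (nat \<Rightarrow> int) \<Rightarrow> (nat \<Rightarrow> nat) set" where
  "matched_counts \<rho> \<delta> = {colour_count S x | S x x'. match_witness \<rho> \<delta> S x x'}"

lemma matched_countsI: "match_witness \<rho> \<delta> S x x' \<Longrightarrow> colour_count S x \<in> matched_counts \<rho> \<delta>"
  unfolding matched_counts_def by blast

definition matchings :: "((nat \<Rightarrow> nat) \<times> (nat \<Rightarrow> int)) set" where
  "matchings = {\<rho>. \<rho> permutes {1..k}} \<times> ({1..k} \<rightarrow>\<^sub>E {- int (card S0)..int (card S0)})"

lemma finite_matchings: "finite matchings"
  by (simp add: matchings_def finite_permutations finite_PiE)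

text \<open>Here \<open>id\<close> is the inclusion of \<open>S - {y}\<close>. As \<open>y\<close>
  avoids the image of the injection, the functor merely forgets the colour of
  \<open>y\<close>.\<close>

lemma delete_point:
  assumes fin: "finite S" and x: "x \<in> F S" and y: "y \<in> S - fst x ` S0"
  shows "F_map S0 (S - {y}) id x = Some (fst x, restrict (snd x) (S - {y} - fst x ` S0))"
    and "colour_count (S - {y}) (fst x, restrict (snd x) (S - {y} - fst x ` S0))
       = (colour_count S x)(snd x y := colour_count S x (snd x y) - 1)"
proof -
  note xD = F_objD[OF x fin]
  have id_eq: "inv_into (S - {y}) id i = i" if "i \<in> S - {y}" for i
    using inv_into_f_f[of id "S - {y}" i] that by simp
  have "fst x s \<in> S - {y}" if "s \<in> S0" for s using xD(5) y that by auto
  then have "compose S0 (inv_into (S - {y}) id) (fst x) = restrict (fst x) S0"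
    by (auto simp: compose_def restrict_def id_eq)
  also have "\<dots> = fst x" using xD(1) by (rule PiE_restrict)
  finally have "compose S0 (inv_into (S - {y}) id) (fst x) = fst x" .
  then show "F_map S0 (S - {y}) id x = Some (fst x, restrict (snd x) (S - {y} - fst x ` S0))"
    using xD(5) y
    by (cases x) (auto simp: F_map_def Let_def compose_def restrict_def image_subset_iff)
  have "{i \<in> S - {y} - fst x ` S0. restrict (snd x) (S - {y} - fst x ` S0) i = c}
      = {i \<in> S - fst x ` S0. snd x i = c} - {y}" for c
    by auto
  then show "colour_count (S - {y}) (fst x, restrict (snd x) (S - {y} - fst x ` S0))
       = (colour_count S x)(snd x y := colour_count S x (snd x y) - 1)"
    using y fin by (auto simp: colour_count_def fun_eq_iff)
qed

text \<open>
  A colour used more than \<open>card S0\<close> times occurs outside the images of both injections. Deleting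
  such a point decreases the count of this colour and that of the matching colour by one.
\<close>

lemma matched_counts_decrement:
  assumes \<rho>: "\<rho> permutes {1..k}" and a: "a \<in> matched_counts \<rho> \<delta>" and c: "card S0 < a c"
  shows "a(c := a c - 1) \<in> matched_counts \<rho> \<delta>"
proof -
  obtain S x x' where w: "match_witness \<rho> \<delta> S x x'" and a_eq: "a = colour_count S x"
    using a by (auto simp: matched_counts_def)
  have fin: "finite S" and R: "(x, x') \<in> R S" using w by (auto simp: match_witness_def)
  have x: "x \<in> F S" "x' \<in> F S" using R_imp_F[OF R fin] .
  have "card (fst x' ` S0) < card {i \<in> S - fst x ` S0. snd x i = c}"
    using c card_image_le[OF finite_S0, of "fst x'"] by (simp add: a_eq colour_count_def)
  then have "\<not> {i \<in> S - fst x ` S0. snd x i = c} \<subseteq> fst x' ` S0"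
    using card_mono[of "fst x' ` S0"] finite_S0 by (meson finite_imageI leD)
  then obtain y where y: "y \<in> S - fst x ` S0" "y \<in> S - fst x' ` S0" "snd x y = c" by blast
  have c_eq: "\<rho> (snd x' y) = c" using w y by (auto simp: match_witness_def)
  let ?S = "S - {y}"
  define u where "u = (fst x, restrict (snd x) (?S - fst x ` S0))"
  define u' where "u' = (fst x', restrict (snd x') (?S - fst x' ` S0))"
  note u = delete_point[OF fin x(1) y(1), folded u_def]
  note u' = delete_point[OF fin x(2) y(2), folded u'_def]
  have "(u, u') \<in> R ?S"
    using axiom1[of ?S S id "fst x" "snd x" "fst x'" "snd x'"] fin R u(1) u'(1)
      F_objD(5)[OF x(1) fin] F_objD(5)[OF x(2) fin] y
    by (force simp: injections_def)
  moreover have "int (colour_count ?S u' d) = int (colour_count ?S u (\<rho> d)) + \<delta> d" if "d \<in> {1..k}" for d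
  proof -
    have eq: "int (colour_count S x' d) = int (colour_count S x (\<rho> d)) + \<delta> d"
      using w that by (auto simp: match_witness_def)
    show ?thesis
    proof (cases "d = snd x' y")
      case True
      \<comment> \<open>Both counts being positive, the truncated decrements are genuine ones and
        keep the difference \<open>\<delta> d\<close>.\<close>
      have "0 < colour_count S x' d"
        using y(2) fin True unfolding colour_count_def by (subst card_gt_0_iff) auto
      then show ?thesis using eq c_eq c a_eq y(3) True by (simp add: u(2) u'(2))
    next
      case False
      then have "\<rho> d \<noteq> c" using c_eq permutes_inj[OF \<rho>] by (auto dest: injD)
      then show ?thesis using eq False y(3) by (simp add: u(2) u'(2))
    qed
  qed
  moreover have "snd u i = \<rho> (snd u' i)" if "i \<in> ?S - (fst u ` S0 \<union> fst u' ` S0)" for i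
    using w that by (auto simp: match_witness_def u_def u'_def)
  ultimately have "match_witness \<rho> \<delta> ?S u u'"
    using fin by (simp add: match_witness_def)
  moreover have "colour_count ?S u = a(c := a c - 1)"
    using u(2) y(3) a_eq by simp
  ultimately show ?thesis using matched_countsI by metis
qed

text \<open>Outside both images \<open>axiom3\<close> makes the colour of \<open>x\<close> an
  injective function of the colour of \<open>x'\<close>; the remaining colours are paired
  arbitrarily. A point counted on one side only lies in the image of the other injection, whence the
  bound \<open>card S0\<close> in both directions.\<close>

lemma exists_matching:
  assumes fin: "finite S" and R: "(x, x') \<in> R S"
  shows "\<exists>(\<rho>, \<delta>)\<in>matchings. match_witness \<rho> \<delta> S x x'"
proof -
  have x: "x \<in> F S" "x' \<in> F S" using R_imp_F[OF R fin] .
  note xD = F_objD[OF x(1) fin] and xD' = F_objD[OF x(2) fin]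
  define U where "U = S - (fst x ` S0 \<union> fst x' ` S0)"
  have ax3: "snd x i = snd x j \<longleftrightarrow> snd x' i = snd x' j" if "i \<in> U" "j \<in> U" for i j
    using axiom3[of S "fst x" "snd x" "fst x'" "snd x'"] fin R that by (auto simp: U_def)
  \<comment> \<open>By \<open>ax3\<close> the colour does not depend on the chosen point.\<close>
  define f where "f c = snd x (SOME i. i \<in> U \<and> snd x' i = c)" for c
  have f: "f (snd x' i) = snd x i" if "i \<in> U" for i
  proof -
    have "\<exists>j. j \<in> U \<and> snd x' j = snd x' i" using that by blast
    from someI_ex[OF this] show ?thesis using ax3 that by (simp add: f_def)
  qed
  have "\<exists>\<rho>. \<rho> permutes {1..k} \<and> (\<forall>c\<in>snd x' ` U. \<rho> c = f c)"
  proof (rule inj_on_extends_to_permutation)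
    have "snd x i \<in> {1..k}" "snd x' i \<in> {1..k}" if "i \<in> U" for i
      using PiE_mem[OF xD(4), of i] PiE_mem[OF xD'(4), of i] that by (simp_all add: U_def)
    then show "snd x' ` U \<subseteq> {1..k}" "f ` snd x' ` U \<subseteq> {1..k}"
      using f by auto
    show "inj_on f (snd x' ` U)" using f ax3 by (auto simp: inj_on_def)
  qed simp
  then obtain \<rho> where \<rho>: "\<rho> permutes {1..k}" "\<And>i. i \<in> U \<Longrightarrow> \<rho> (snd x' i) = snd x i"
    using f by auto
  have bound: "card A \<le> card B + card S0"
    if "A \<subseteq> B \<union> g ` S0" "finite B" for A B :: "nat set" and g :: "'s \<Rightarrow> nat"
  proof -
    have "card A \<le> card (B \<union> g ` S0)"
      using that finite_S0 by (intro card_mono) auto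
    also have "\<dots> \<le> card B + card (g ` S0)" by (rule card_Un_le)
    also have "\<dots> \<le> card B + card S0" using finite_S0 by (simp add: card_image_le)
    finally show ?thesis .
  qed
  define \<delta> where "\<delta> = (\<lambda>c\<in>{1..k}. int (colour_count S x' c) - int (colour_count S x (\<rho> c)))"
  have "\<delta> c \<in> {- int (card S0)..int (card S0)}" if "c \<in> {1..k}" for c
  proof -
    have "colour_count S x (\<rho> c) \<le> colour_count S x' c + card S0"
      unfolding colour_count_def
    proof (rule bound)
      show "{i \<in> S - fst x ` S0. snd x i = \<rho> c} \<subseteq> {i \<in> S - fst x' ` S0. snd x' i = c} \<union> fst x' ` S0"
        using \<rho>(2) permutes_inj[OF \<rho>(1), THEN inj_eq] by (force simp: U_def)
    qed (use fin in auto)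
    moreover have "colour_count S x' c \<le> colour_count S x (\<rho> c) + card S0"
      unfolding colour_count_def
    proof (rule bound)
      show "{i \<in> S - fst x' ` S0. snd x' i = c} \<subseteq> {i \<in> S - fst x ` S0. snd x i = \<rho> c} \<union> fst x ` S0"
        using \<rho>(2) by (auto simp: U_def)
    qed (use fin in auto)
    ultimately show ?thesis using that by (simp add: \<delta>_def)
  qed
  then have "(\<rho>, \<delta>) \<in> matchings" using \<rho>(1) by (auto simp: matchings_def \<delta>_def)
  moreover have "match_witness \<rho> \<delta> S x x'"
    using fin R \<rho>(2) by (simp add: match_witness_def \<delta>_def U_def)
  ultimately show ?thesis by blast
qed

section \<open>Lexicographically least counts\<close>

text \<open>This says that the partner of \<open>a\<close> under the matching is smaller for
  \<open>less_fun\<close>, expressed through \<open>a\<close> alone, so that only the differences of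
  \<open>a (\<rho> i)\<close> and \<open>a i\<close> enter.\<close>

definition lex_decreasing :: "(nat \<Rightarrow> nat) \<Rightarrow> (nat \<Rightarrow> int) \<Rightarrow> (nat \<Rightarrow> nat) \<Rightarrow> bool" where
  "lex_decreasing \<rho> \<delta> a \<longleftrightarrow> (\<exists>i\<in>{1..k}. int (a (\<rho> i)) + \<delta> i < int (a i) \<and>
     (\<forall>j\<in>{1..k}. j < i \<longrightarrow> int (a (\<rho> j)) + \<delta> j = int (a j)))"

lemma match_witness_lex:
  assumes "match_witness \<rho> \<delta> S x x'"
  shows "less_fun (colour_count S x') (colour_count S x) \<longleftrightarrow> lex_decreasing \<rho> \<delta> (colour_count S x)"
proof -
  have fin: "finite S" and R: "(x, x') \<in> R S"
    and eq: "\<And>c. c \<in> {1..k} \<Longrightarrow> int (colour_count S x' c) = int (colour_count S x (\<rho> c)) + \<delta> c"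
    using assms by (auto simp: match_witness_def)
  have 0: "colour_count S x' c = 0" "colour_count S x c = 0" if "c \<notin> {1..k}" for c
    using that R_imp_F[OF R fin] fin by (auto intro!: vectorsD[OF colour_count_in_vectors])
  have lt: "colour_count S x' i < colour_count S x i \<longleftrightarrow>
      i \<in> {1..k} \<and> int (colour_count S x (\<rho> i)) + \<delta> i < int (colour_count S x i)" for i
    using 0[of i] eq[of i] by (cases "i \<in> {1..k}") auto
  have same: "colour_count S x' i = colour_count S x i \<longleftrightarrow>
      (i \<in> {1..k} \<longrightarrow> int (colour_count S x (\<rho> i)) + \<delta> i = int (colour_count S x i))" for i
    using 0[of i] eq[of i] by (cases "i \<in> {1..k}") auto
  show ?thesis unfolding less_fun_def lex_decreasing_def lt same by blast
qed

text \<open>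
  The counts that are lexicographically minimal among the counts of equivalent elements.
\<close>

definition canonical_counts :: "(nat \<Rightarrow> nat) set" where
  "canonical_counts =
     (\<Union>(\<rho>, \<delta>)\<in>matchings. matched_counts \<rho> \<delta>)
     - (\<Union>(\<rho>, \<delta>)\<in>matchings. {a \<in> matched_counts \<rho> \<delta>. lex_decreasing \<rho> \<delta> a})"

text \<open>A witness for a matched count may live on any finite set. The coordinate sum forces that
  set to have \<open>n\<close> points, so a bijection moves its elements to \<open>{1..n}\<close>,
  and \<open>R_transport\<close> moves a smaller partner likewise.\<close>

lemma canonical_counts_of_sum:
  assumes n: "card S0 \<le> n"
  shows "vectors_of_sum {1..k} (n - card S0) \<inter> canonical_counts =
    {a \<in> colour_count {1..n} ` F {1..n}. \<forall>b\<in>colour_count {1..n} ` F {1..n}.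
       classes_of_count {1..n} b = classes_of_count {1..n} a \<longrightarrow> \<not> less_fun b a}"
    (is "?L = ?R")
proof
  let ?S = "{1..n}"
  show "?R \<subseteq> ?L"
  proof
    fix a assume a: "a \<in> ?R"
    then obtain x where x: "x \<in> F ?S" "a = colour_count ?S x" by blast
    have "\<not> lex_decreasing \<rho> \<delta> a" if a_mc: "a \<in> matched_counts \<rho> \<delta>" for \<rho> \<delta>
    proof -
      obtain T z z' where w: "match_witness \<rho> \<delta> T z z'" "a = colour_count T z"
        using a_mc by (auto simp: matched_counts_def)
      then have "finite T" "(z, z') \<in> R T" by (auto simp: match_witness_def)
      then obtain y where y: "(x, y) \<in> R ?S" "colour_count ?S y = colour_count T z'"
        using R_transport[OF _ \<open>finite T\<close> \<open>(z, z') \<in> R T\<close> x(1)] w(2) x(2) by auto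
      then have "classes_of_count ?S (colour_count ?S y) = classes_of_count ?S a"
        using classes_of_count_eq_iff[OF _ x(1), of "colour_count ?S y"] x(2) y(1)
        by (metis finite_atLeastAtMost)
      moreover have "colour_count ?S y \<in> colour_count ?S ` F ?S"
        using R_imp_F(2)[OF y(1)] by simp
      ultimately have "\<not> less_fun (colour_count T z') a" using a y(2) by auto
      then show ?thesis using match_witness_lex[OF w(1)] w(2) by simp
    qed
    \<comment> \<open>The reflexive pair already puts \<open>a\<close> into the union of the matched
      counts.\<close>
    moreover obtain \<rho> \<delta> where "(\<rho>, \<delta>) \<in> matchings" "match_witness \<rho> \<delta> ?S x x"
      using exists_matching[OF _ R_refl[OF _ x(1)]] by auto
    then have "(\<rho>, \<delta>) \<in> matchings \<and> a \<in> matched_counts \<rho> \<delta>"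
      using x(2) matched_countsI by metis
    moreover have "a \<in> vectors_of_sum {1..k} (n - card S0)"
      using colour_count_in_vectors_of_sum(1)[OF x(1)] x(2) by simp
    ultimately show "a \<in> ?L" by (auto simp: canonical_counts_def)
  qed
  show "?L \<subseteq> ?R"
  proof
    fix a assume a: "a \<in> ?L"
    then obtain \<rho> \<delta> where "a \<in> matched_counts \<rho> \<delta>" by (auto simp: canonical_counts_def)
    then obtain T z z' where w: "match_witness \<rho> \<delta> T z z'" "a = colour_count T z"
      unfolding matched_counts_def by blast
    then have z: "finite T" "z \<in> F T" "a = colour_count T z"
      using R_imp_F(1)[of z z' T] by (simp_all add: match_witness_def)
    \<comment> \<open>Because \<open>card S0 \<le> n\<close>, the truncated subtraction
      \<open>n - card S0\<close> determines \<open>n\<close>.\<close>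
    have "card T = card ?S"
      using colour_count_in_vectors_of_sum[OF z(2,1)] a z(3) n by (auto simp: vectors_of_sum_def)
    then obtain p where p: "bij_betw p ?S T"
      using finite_same_card_bij[of ?S T] z(1) by auto
    obtain x where x: "x \<in> F ?S" "corresponds p ?S z x"
      using F_map_corresponds[OF p _ z(1,2)] by blast
    have a_eq: "a = colour_count ?S x"
      using corresponds_colour_count[OF p _ x] z(3) by simp
    have "\<not> less_fun b a" if b: "classes_of_count ?S b = classes_of_count ?S a" for b
    proof -
      obtain y where y: "(x, y) \<in> R ?S" "colour_count ?S y = b"
        using classes_of_count_eq_iff[OF _ x(1), of b] b a_eq by (metis finite_atLeastAtMost)
      obtain \<rho> \<delta> where w: "(\<rho>, \<delta>) \<in> matchings" "match_witness \<rho> \<delta> ?S x y"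
        using exists_matching[OF _ y(1)] by auto
      then have "a \<in> matched_counts \<rho> \<delta>" using a_eq matched_countsI by metis
      then have "\<not> lex_decreasing \<rho> \<delta> a" using a w(1) by (auto simp: canonical_counts_def)
      then show ?thesis using match_witness_lex[OF w(2)] y(2) a_eq by simp
    qed
    then show "a \<in> ?R" using x(1) a_eq by blast
  qed
qed

lemma card_orbits:
  assumes "card S0 \<le> n"
  shows "card (orbits (sym_group n) (model_obj S0 E R {1..n}) (sym_action S0 E R n))
    = card (vectors_of_sum {1..k} (n - card S0) \<inter> canonical_counts)"
  unfolding orbits_eq_image canonical_counts_of_sum[OF assms]
proof (rule card_image_eq_card_minimal)
  have V: "colour_count {1..n} ` F {1..n} \<subseteq> vectors_of_sum {1..k} (n - card S0)"
    using colour_count_in_vectors_of_sum(1)[of _ "{1..n}"] by auto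
  then show "finite (colour_count {1..n} ` F {1..n})"
    using finite_vectors_of_sum finite_subset by blast
  show "asymp (less_fun :: (nat \<Rightarrow> nat) \<Rightarrow> _)" by (rule asympI) (rule less_fun_asym)
  show "transp (less_fun :: (nat \<Rightarrow> nat) \<Rightarrow> _)" by (rule transpI) (rule less_fun_trans)
  show "less_fun a b \<or> a = b \<or> less_fun b a"
    if "a \<in> colour_count {1..n} ` F {1..n}" "b \<in> colour_count {1..n} ` F {1..n}" for a b
  proof (rule less_fun_trichotomy)
    have "{i. a i \<noteq> b i} \<subseteq> {1..k}"
    proof
      fix i assume "i \<in> {i. a i \<noteq> b i}"
      moreover have "a \<in> vectors {1..k}" "b \<in> vectors {1..k}"
        using that V by (auto simp: vectors_of_sum_def)
      ultimately show "i \<in> {1..k}" using vectorsD[of a _ i] vectorsD[of b _ i] by force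
    qed
    then show "finite {i. a i \<noteq> b i}" by (rule finite_subset) simp
  qed
qed

text \<open>Only finitely many matchings enter: truncated coordinates decide membership in each set
  of matched counts, and truncated differences decide the lexicographic comparison.\<close>

lemma canonical_counts_invariant:
  "\<exists>M>0. truncated_differences_invariant {1..k} M canonical_counts"
proof -
  have "\<forall>q\<in>matchings. \<exists>M. \<forall>a\<in>vectors {1..k}.
      a \<in> case_prod matched_counts q \<longleftrightarrow> (\<lambda>i. min (a i) M) \<in> case_prod matched_counts q"
    using matched_counts_decrement
    by (intro ballI decrement_closed_imp_truncation_invariant[where m = "card S0"])
       (auto simp: matchings_def)
  then obtain B where B: "\<And>\<rho> \<delta> a. (\<rho>, \<delta>) \<in> matchings \<Longrightarrow> a \<in> vectors {1..k} \<Longrightarrow>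
      a \<in> matched_counts \<rho> \<delta> \<longleftrightarrow> (\<lambda>i. min (a i) (B (\<rho>, \<delta>))) \<in> matched_counts \<rho> \<delta>"
    by (metis case_prod_conv)
  \<comment> \<open>Exceeding every \<open>B q\<close> makes truncation at \<open>M\<close> fine
    enough for all matched counts. Exceeding \<open>card S0\<close> strictly ensures that a
    difference cut off at \<open>M\<close> is never mistaken for one that equals an offset
    \<open>\<delta> i\<close> up to sign.\<close>
  define M where "M = Max (insert (Suc (card S0)) (B ` matchings))"
  have M: "card S0 < M" "\<And>q. q \<in> matchings \<Longrightarrow> B q \<le> M"
    unfolding M_def using finite_matchings by (auto intro!: Max_ge simp: Max_gr_iff simp del: Max_insert)
  have "b \<in> canonical_counts"
    if ab: "a \<in> vectors {1..k}" "b \<in> vectors {1..k}"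
      and trunc: "\<forall>i\<in>{1..k}. min (a i) M = min (b i) M"
      and diff: "\<forall>i\<in>{1..k}. \<forall>j\<in>{1..k}. min (a i - a j) M = min (b i - b j) M"
      and a: "a \<in> canonical_counts" for a b
  proof -
    have "a \<in> matched_counts \<rho> \<delta> \<longleftrightarrow> b \<in> matched_counts \<rho> \<delta>" if q: "(\<rho>, \<delta>) \<in> matchings" for \<rho> \<delta>
    proof -
      have "min (a i) (B (\<rho>, \<delta>)) = min (b i) (B (\<rho>, \<delta>))" for i
      proof (cases "i \<in> {1..k}")
        case True
        then have "min (a i) M = min (b i) M" using trunc by blast
        then show ?thesis using M(2)[OF q] by (auto simp: min_def split: if_splits)
      next
        case False
        then show ?thesis using vectorsD ab by metis
      qed
      then show ?thesis using B[OF q ab(1)] B[OF q ab(2)] by simp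
    qed
    moreover have "lex_decreasing \<rho> \<delta> a \<longleftrightarrow> lex_decreasing \<rho> \<delta> b" if q: "(\<rho>, \<delta>) \<in> matchings" for \<rho> \<delta>
    proof -
      have *: "(int (a (\<rho> i)) + \<delta> i < int (a i) \<longleftrightarrow> int (b (\<rho> i)) + \<delta> i < int (b i)) \<and>
          (int (a (\<rho> i)) + \<delta> i = int (a i) \<longleftrightarrow> int (b (\<rho> i)) + \<delta> i = int (b i))"
        if i: "i \<in> {1..k}" for i
      proof -
        have \<rho>i: "\<rho> i \<in> {1..k}" using q i permutes_in_image[of \<rho> "{1..k}" i] by (simp add: matchings_def)
        have "\<delta> i \<in> {- int (card S0)..int (card S0)}" using q i by (auto simp: matchings_def)
        then have "- int M < \<delta> i" "\<delta> i < int M" using M(1) by auto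
        moreover have "min (a i - a (\<rho> i)) M = min (b i - b (\<rho> i)) M"
          "min (a (\<rho> i) - a i) M = min (b (\<rho> i) - b i) M"
          using diff i \<rho>i by blast+
        ultimately show ?thesis by (simp add: min_def split: if_splits) linarith+
      qed
      show ?thesis unfolding lex_decreasing_def using * by (metis (no_types, lifting))
    qed
    ultimately show ?thesis using a by (auto simp: canonical_counts_def)
  qed
  then have "truncated_differences_invariant {1..k} M canonical_counts"
    unfolding truncated_differences_invariant_def by blast
  moreover have "0 < M" using M(1) by simp
  ultimately show ?thesis by blast
qed

lemma eventually_quasipoly_card_orbits:
  "eventually_quasipoly
     (\<lambda>n. real (card (orbits (sym_group n) (model_obj S0 E R {1..n}) (sym_action S0 E R n))))"
proof -
  obtain M where "M > 0" "truncated_differences_invariant {1..k} M canonical_counts"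
    using canonical_counts_invariant by blast
  then have "eventually_quasipoly (\<lambda>n. real (card (vectors_of_sum {1..k} n \<inter> canonical_counts)))"
    by (intro eventually_quasipoly_card_truncated_differences_invariant) auto
  then have "eventually_quasipoly
      (\<lambda>n. real (card (vectors_of_sum {1..k} (n - card S0) \<inter> canonical_counts)))"
    by (rule eventually_quasipoly_shift_down)
  then show ?thesis
    by (rule eventually_quasipoly_cong[where M = "card S0"]) (simp only: card_orbits)
qed

end

theorem theorem5p16:
  fixes S0 :: "'s set"
    and k :: nat
    and E :: "nat set \<Rightarrow> (nat \<Rightarrow> nat) set"
    and R :: "nat set \<Rightarrow> ('s elt \<times> 's elt) set"
  assumes "model_functor S0 k E R"
  shows "\<exists>f. quasipolynomial f \<and>
           (\<exists>N. \<forall>n\<ge>N. real (card (orbits (sym_group n) (model_obj S0 E R {1..n})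
                                   (sym_action S0 E R n))) = f (int n))"
  using model_functor.eventually_quasipoly_card_orbits[OF assms]
  by (rule eventually_quasipoly_imp_quasipolynomial)

end
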